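(* Let $G=(V,E)$ be a strongly connected social network, with $V$ finite or countably infinite, and suppose that $(\mu_0,\mu_1)$ induce non-atomic beliefs. Then there exists a random variable $A$ such that almost surely $A_u=A$ for all $u\in V$, where $A_u$ denotes the optimal action set of agent $u$.
   Context: Model. Let $\mu_0\neq\mu_1$ be mutually absolutely continuous probability measures on a measurable space $(\Omega,\mathcal{O})$. $V$ is a countable (finite or infinite) set of agents. The state of the world $S\in\{0,1\}$ and private signals $W_u\in\Omega$ ($u\in V$) have joint law $\frac12\delta_0\mu_0^V+\frac12\delta_1\mu_1^V$: $S$ is uniform on $\{0,1\}$ and, conditioned on $S$, the $W_u$ are i.i.d. with law $\mu_S$. The social network $G=(V,E)$ is a simple (no loops or parallel edges), strongly connected directed graph; $N(u)=\{v:(u,v)\in E\}$ is the set of agents that $u$ observes. For $t=1,2,\dots$ the information $\mathcal{F}_u(t)$ and action $A_u(t)\in\{0,1\}$ of agent $u$ are defined jointly by $\mathcal{F}_u(t)=\sigma(W_u,\{A_v(t'):v\in N(u),t'<t\})$ and $A_u(t)=0$ if $\mathbb{P}[S=1|\mathcal{F}_u(t)]<1/2$, $A_u(t)=1$ if $\mathbb{P}[S=1|\mathcal{F}_u(t)]>1/2$; if $\mathbb{P}[S=1|\mathcal{F}_u(t)]=1/2$ then $A_u(t)\in\{0,1\}$ is given by some tie-breaking rule ($A_u(t)$ is $\mathcal{F}_u(t)$-measurable; nothing else is assumed about ties). The belief of $u$ at time $t$ is $X_u(t)=\mathbb{P}[S=1|\mathcal{F}_u(t)]$; the initial belief is $X_u(1)=\mathbb{P}[S=1|W_u]$.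 The pair $(\mu_0,\mu_1)$ induces non-atomic beliefs if the distribution of $X_u(1)$ is non-atomic. Let $\mathcal{F}_u$ be the $\sigma$-algebra generated by $\bigcup_t\mathcal{F}_u(t)$ and $X_u=\mathbb{P}[S=1|\mathcal{F}_u]$, so $X_u=\lim_tX_u(t)$ a.s. The optimal action set is $A_u=\{0\}$ if $X_u<1/2$, $A_u=\{1\}$ if $X_u>1/2$, $A_u=\{0,1\}$ if $X_u=1/2$. *)

theory Defs
  imports "HOL-Probability.Probability" "Graph_Theory.Digraph_Component"
begin

text \<open>
  Agents are the vertices \<open>pverts G\<close>, and \<open>(u, v) \<in> parcs G\<close> means that \<open>u\<close> observes \<open>v\<close>.
  The states and the actions are the natural numbers 0 and 1. Time starts at 1, so that
  \<open>A u 0\<close> is never referred to.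
\<close>

definition information ::
  "'a measure \<Rightarrow> 'w measure \<Rightarrow> 'v pair_pre_digraph \<Rightarrow> ('v \<Rightarrow> 'a \<Rightarrow> 'w) \<Rightarrow>
    ('v \<Rightarrow> nat \<Rightarrow> 'a \<Rightarrow> nat) \<Rightarrow> 'v \<Rightarrow> nat \<Rightarrow> 'a measure" where
  "information M \<Omega> G W A u t = sigma (space M)
     ({W u -` B \<inter> space M |B. B \<in> sets \<Omega>} \<union>
      {A v t' -` C \<inter> space M |v t' C. (u, v) \<in> parcs G \<and> 1 \<le> t' \<and> t' < t})"

definition limit_information ::
  "'a measure \<Rightarrow> 'w measure \<Rightarrow> 'v pair_pre_digraph \<Rightarrow> ('v \<Rightarrow> 'a \<Rightarrow> 'w) \<Rightarrow>
    ('v \<Rightarrow> nat \<Rightarrow> 'a \<Rightarrow> nat) \<Rightarrow> 'v \<Rightarrow> 'a measure" where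
  "limit_information M \<Omega> G W A u =
     sigma (space M) (\<Union>t\<in>{1..}. sets (information M \<Omega> G W A u t))"

text \<open>A version of \<open>\<P>[S = 1 | F]\<close>.\<close>

definition posterior :: "'a measure \<Rightarrow> ('a \<Rightarrow> nat) \<Rightarrow> 'a measure \<Rightarrow> 'a \<Rightarrow> real" where
  "posterior M S F = real_cond_exp M F (indicator {\<omega> \<in> space M. S \<omega> = 1})"

definition optimal_actions ::
  "'a measure \<Rightarrow> 'w measure \<Rightarrow> 'v pair_pre_digraph \<Rightarrow> ('a \<Rightarrow> nat) \<Rightarrow> ('v \<Rightarrow> 'a \<Rightarrow> 'w) \<Rightarrow>
    ('v \<Rightarrow> nat \<Rightarrow> 'a \<Rightarrow> nat) \<Rightarrow> 'v \<Rightarrow> 'a \<Rightarrow> nat set" where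
  "optimal_actions M \<Omega> G S W A u \<omega> =
     (let x = posterior M S (limit_information M \<Omega> G W A u) \<omega>
      in if x < 1/2 then {0} else if x > 1/2 then {1} else {0, 1})"

text \<open>
  The measurable space of signals enters as \<open>\<mu>0\<close>, which has the same measurable sets as \<open>\<mu>1\<close>.
  The assumption \<open>joint_law\<close> says that \<open>(S, (W u)\<^sub>u)\<close> has law
  \<open>1/2 \<delta>\<^sub>0 \<mu>0\<^sup>V + 1/2 \<delta>\<^sub>1 \<mu>1\<^sup>V\<close>. Beliefs, and hence the decision rule, are only determined
  up to null sets. The tie-breaking rule is left open: on ties, \<open>action_measurable\<close> is the only
  constraint on the action.
\<close>

locale social_learning =
  fixes M :: "'a measure"
    and \<mu>0 \<mu>1 :: "'w measure"
    and G :: "'v pair_pre_digraph"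
    and S :: "'a \<Rightarrow> nat"
    and W :: "'v \<Rightarrow> 'a \<Rightarrow> 'w"
    and A :: "'v \<Rightarrow> nat \<Rightarrow> 'a \<Rightarrow> nat"
  assumes prob_space_M: "prob_space M"
    and prob_space_signals: "prob_space \<mu>0" "prob_space \<mu>1"
    and sets_signals: "sets \<mu>0 = sets \<mu>1"
    and signals_differ: "\<mu>0 \<noteq> \<mu>1"
    and mutually_abs_cont: "absolutely_continuous \<mu>0 \<mu>1" "absolutely_continuous \<mu>1 \<mu>0"
    and countable_agents: "countable (pverts G)"
    and simple_network: "pair_loopfree_digraph G"
    and strongly_connected_network: "strongly_connected (with_proj G)"
    and state_measurable: "S \<in> measurable M (count_space {0, 1})"
    and signal_measurable: "\<And>u. u \<in> pverts G \<Longrightarrow> W u \<in> measurable M \<mu>0"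
    and joint_law: "\<And>B. B \<in> sets (count_space {0, 1} \<Otimes>\<^sub>M Pi\<^sub>M (pverts G) (\<lambda>_. \<mu>0)) \<Longrightarrow>
      emeasure (distr M (count_space {0, 1} \<Otimes>\<^sub>M Pi\<^sub>M (pverts G) (\<lambda>_. \<mu>0))
          (\<lambda>\<omega>. (S \<omega>, \<lambda>u\<in>pverts G. W u \<omega>))) B =
        1/2 * emeasure (return (count_space {0, 1}) 0 \<Otimes>\<^sub>M Pi\<^sub>M (pverts G) (\<lambda>_. \<mu>0)) B +
        1/2 * emeasure (return (count_space {0, 1}) 1 \<Otimes>\<^sub>M Pi\<^sub>M (pverts G) (\<lambda>_. \<mu>1)) B"
    and action_measurable: "\<And>u t. u \<in> pverts G \<Longrightarrow> 1 \<le> t \<Longrightarrow>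
      A u t \<in> measurable (information M \<mu>0 G W A u t) (count_space {0, 1})"
    and action_myopic: "\<And>u t. u \<in> pverts G \<Longrightarrow> 1 \<le> t \<Longrightarrow>
      AE \<omega> in M.
        (posterior M S (information M \<mu>0 G W A u t) \<omega> < 1/2 \<longrightarrow> A u t \<omega> = 0) \<and>
        (posterior M S (information M \<mu>0 G W A u t) \<omega> > 1/2 \<longrightarrow> A u t \<omega> = 1)"

definition non_atomic :: "'a measure \<Rightarrow> bool" where
  "non_atomic N \<longleftrightarrow> \<not> (\<exists>B\<in>sets N. emeasure N B > 0 \<and>
     (\<forall>C\<in>sets N. C \<subseteq> B \<longrightarrow> emeasure N C < emeasure N B \<longrightarrow> emeasure N C = 0))"

text \<open>
  The law of the belief at time 1 depends only on \<open>\<mu>0\<close> and \<open>\<mu>1\<close>; in particular it is the same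
  for all agents.
\<close>

definition non_atomic_beliefs ::
  "'a measure \<Rightarrow> 'w measure \<Rightarrow> 'v pair_pre_digraph \<Rightarrow> ('a \<Rightarrow> nat) \<Rightarrow> ('v \<Rightarrow> 'a \<Rightarrow> 'w) \<Rightarrow>
    ('v \<Rightarrow> nat \<Rightarrow> 'a \<Rightarrow> nat) \<Rightarrow> bool" where
  "non_atomic_beliefs M \<Omega> G S W A \<longleftrightarrow>
     (\<forall>u\<in>pverts G. non_atomic (distr M borel (posterior M S (information M \<Omega> G W A u 1))))"

end

(*
  Write gain Q = P(Q, S = 1) - P(Q, S = 0). Among the events of a sub-sigma-algebra, gain is
  maximised by {posterior > 1/2}, and by an event Q only if the posterior is at least 1/2 on Q and
  at most 1/2 off Q. Myopic optimality makes "u plays 1 infinitely often" and "u plays 1 from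
  some time on" at least as good as everything u learns in the limit. An agent v that observes u can
  imitate these two events, so on a strongly connected network all agents have the same maximal
  gain, and the limit behaviour of u is optimal for v, too.

  It remains to exclude that v has a strict preference while u is indifferent. In that case the
  actions of u are eventually constant, so they follow one of countably many fixed sequences a.
  If u were forced to play a, whatever u observes would be a function of the signals of the others,
  hence, given S, independent of the signal of u. The posterior of u would then be 1/2 only where
  the initial belief q of u and the belief p based on the observations satisfy q + p = 1, which is
  a null event because q has no atoms.
*)

theory Submission
  imports Defs
begin

text \<open>Forcing \<open>u\<close> to play \<open>a\<close> suggests a counterfactual process, but
  none is built. The obstacle is that neighbours react to what \<open>u\<close> plays, so the
  actions that \<open>u\<close> observes need not be conditionally independent of the signal of
  \<open>u\<close>. The event \<open>trajectory u a\<close> freezes this feedback: restricted to it,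
  each observed action coincides with an event about the signals of the others, and sigma-algebras
  are compared only through their traces on it. Each trajectory yields a null event of its own, so
  only countably many may be used; this is why eventual constancy matters.

  Two limit events are needed because each bounds the belief of an observer on one side only. On
  their difference, where \<open>u\<close> oscillates, every observer of \<open>u\<close> is pinned
  at 1/2. Preferences of \<open>v\<close> and \<open>u\<close> on opposite sides are excluded by
  applying the one-sided bounds to \<open>v\<close> and to \<open>u\<close> itself, which leaves
  indifference as the only remaining case.\<close>

section \<open>Sub-sigma-algebras and conditional independence\<close>

text \<open>The sets whose trace on \<open>D\<close> is realised by a set of \<open>N\<close> are
  closed under complement and countable union, so generators suffice. This is the device by which
  two sigma-algebras are compared on one event only.\<close>

lemma sigma_sets_trace:
  assumes "Q \<in> sigma_sets X E" and "\<And>g. g \<in> E \<Longrightarrow> \<exists>B\<in>sets N. g \<inter> D = B \<inter> D" and "space N = X"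
  shows "\<exists>B\<in>sets N. Q \<inter> D = B \<inter> D"
  using assms(1)
proof induction
  case (Basic a) then show ?case using assms by auto
next
  case Empty then show ?case by (auto intro!: bexI[of _ "{}"])
next
  case (Compl a)
  then obtain B where B: "B \<in> sets N" "a \<inter> D = B \<inter> D" by auto
  then have "(X - a) \<inter> D = (space N - B) \<inter> D" using assms(3) by auto
  with B show ?case by auto
next
  case (Union a)
  then obtain B where B: "\<And>i. B i \<in> sets N" "\<And>i. a i \<inter> D = B i \<inter> D" by metis
  have "\<Union> (range a) \<inter> D = (\<Union>i. a i \<inter> D)" by auto
  also have "\<dots> = \<Union> (range B) \<inter> D" using B(2) by auto
  finally have "\<Union> (range a) \<inter> D = \<Union> (range B) \<inter> D" .
  with B show ?case by auto
qed

text \<open>Sets that can be approximated in symmetric difference by sets of some stage form a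
  sigma-algebra: complements keep the difference, and a countable union is first cut to a finite
  one, whose members fit into a common stage.\<close>

lemma (in finite_measure) sigma_sets_approx:
  fixes F :: "nat \<Rightarrow> 'a measure"
  assumes sub: "\<And>n. subalgebra M (F n)" and mono: "\<And>n. sets (F n) \<subseteq> sets (F (Suc n))"
    and Q: "Q \<in> sigma_sets (space M) (\<Union>n. sets (F n))" and "e > 0"
  shows "\<exists>n. \<exists>R\<in>sets (F n). measure M ((Q - R) \<union> (R - Q)) < e"
  using Q \<open>e > 0\<close>
proof (induction arbitrary: e)
  case (Basic a)
  then obtain n where "a \<in> sets (F n)" by auto
  with \<open>0 < e\<close> show ?case by (intro exI[of _ n] bexI[of _ a]) auto
next
  case Empty then show ?case by (auto intro!: bexI[of _ "{}"])
next
  case (Compl a)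
  then obtain n R where R: "R \<in> sets (F n)" "measure M ((a - R) \<union> (R - a)) < e" by metis
  have eq: "space (F n) = space M" using sub by (auto simp: subalgebra_def)
  have R': "R \<subseteq> space M" using sets.sets_into_space[OF R(1)] eq by simp
  have "(space M - a - (space M - R)) \<union> (space M - R - (space M - a)) = (a - R) \<union> (R - a) \<inter> space M
     \<or> \<not> a \<subseteq> space M" using R' by auto
  moreover have "a \<subseteq> space M" using sigma_sets_into_sp[OF _ Compl(1)] sub sets.sets_into_space
    by (force simp: subalgebra_def)
  ultimately have "(space M - a - (space M - R)) \<union> (space M - R - (space M - a)) = (a - R) \<union> (R - a)"
    using R' by auto
  moreover have "space M - R \<in> sets (F n)" using R(1) eq by (metis sets.compl_sets)
  ultimately show ?case using R(2) by metis
next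
  case (Union a)
  have subM: "sigma_sets (space M) (\<Union>n. sets (F n)) \<subseteq> sets M"
    using sub by (intro sets.sigma_sets_subset) (auto simp: subalgebra_def)
  have aM: "a i \<in> sets M" for i using Union(1) subM by auto
  have le: "sets (F n) \<subseteq> sets (F m)" if "n \<le> m" for n m
    using that mono by (rule lift_Suc_mono_le[of "\<lambda>n. sets (F n)", rotated])
  define U where "U m = (\<Union>i<m. a i)" for m
  have "(\<lambda>m. measure M (U m)) \<longlonglongrightarrow> measure M (\<Union>m. U m)"
    using aM by (intro finite_Lim_measure_incseq) (auto simp: U_def incseq_def intro: less_le_trans)
  moreover have Ueq: "(\<Union>m. U m) = \<Union> (range a)" by (auto simp: U_def)
  ultimately obtain m where "dist (measure M (U m)) (measure M (\<Union> (range a))) < e / 2"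
    using \<open>e > 0\<close> unfolding lim_sequentially by (metis half_gt_zero order_refl)
  moreover have "measure M (\<Union> (range a)) - measure M (U m) = measure M (\<Union> (range a) - U m)"
    using aM by (intro finite_measure_Diff[symmetric]) (auto simp: U_def)
  ultimately have m: "measure M (\<Union> (range a) - U m) < e / 2" unfolding dist_real_def by linarith
  \<comment> \<open>Half of \<open>e\<close> is spent on the tail of the union, the other half is
    shared by the first \<open>m\<close> sets; \<open>Suc m\<close> keeps the denominator positive
    when \<open>m = 0\<close>.\<close>
  have "\<exists>n. \<exists>R\<in>sets (F n). measure M ((a i - R) \<union> (R - a i)) < e / (2 * Suc m)" for i
    by (rule Union(2)) (use \<open>e > 0\<close> in auto)
  then obtain n R where R: "\<And>i. R i \<in> sets (F (n i))"
    "\<And>i. measure M ((a i - R i) \<union> (R i - a i)) < e / (2 * Suc m)" by metis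
  have RM: "R i \<in> sets M" for i using R(1)[of i] sub[of "n i"] by (auto simp: subalgebra_def)
  \<comment> \<open>A stage containing all \<open>m\<close> approximants; inserting 0 keeps
    \<open>Max\<close> meaningful when \<open>m = 0\<close>.\<close>
  define k where "k = Max (insert 0 (n ` {..<m}))"
  have Rk: "(\<Union>i<m. R i) \<in> sets (F k)"
  proof (intro sets.finite_UN)
    fix i assume "i \<in> {..<m}"
    then have "n i \<le> k" unfolding k_def by auto
    then show "R i \<in> sets (F k)" using le R(1) by auto
  qed auto
  let ?V = "\<Union>i<m. R i" and ?A = "\<Union> (range a)"
  have "measure M ((?A - ?V) \<union> (?V - ?A)) \<le>
      measure M ((?A - U m) \<union> (\<Union>i<m. (a i - R i) \<union> (R i - a i)))"
    using aM RM by (intro finite_measure_mono) (auto simp: U_def)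
  also have "\<dots> \<le> measure M (?A - U m) + measure M (\<Union>i<m. (a i - R i) \<union> (R i - a i))"
    using aM RM by (intro measure_Un_le) (auto simp: U_def)
  also have "measure M (\<Union>i<m. (a i - R i) \<union> (R i - a i)) \<le> (\<Sum>i<m. measure M ((a i - R i) \<union> (R i - a i)))"
    using aM RM by (intro finite_measure_subadditive_finite) auto
  also have "\<dots> \<le> (\<Sum>i<m. e / (2 * Suc m))" using R(2) by (intro sum_mono) (auto intro: less_imp_le)
  also have "\<dots> \<le> e / 2" using \<open>e > 0\<close> by (simp add: field_simps)
  finally have "measure M ((?A - ?V) \<union> (?V - ?A)) < e" using m by linarith
  with Rk show ?case by auto
qed

section \<open>Densities for conditionally independent sigma-algebras\<close>

text \<open>
  Conditional independence says that the law of the diagonal map \<open>\<omega> \<mapsto> (\<omega>, \<omega>)\<close> on \<open>E\<close> has a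
  density with respect to the product of the two restrictions of \<open>M\<close>; the factor 2 is
  \<open>1 / P(E)\<close>.
\<close>

lemma (in prob_space) density_of_cond_indep:
  fixes f g :: "'a \<Rightarrow> ennreal"
  assumes F: "subalgebra M F" and K: "subalgebra M K" and E: "E \<in> events"
    and f: "f \<in> borel_measurable F" and g: "g \<in> borel_measurable K"
    and fE: "\<And>B. B \<in> sets F \<Longrightarrow> (\<integral>\<^sup>+x. f x * indicator B x \<partial>M) = emeasure M (B \<inter> E)"
    and gE: "\<And>C. C \<in> sets K \<Longrightarrow> (\<integral>\<^sup>+x. g x * indicator C x \<partial>M) = emeasure M (C \<inter> E)"
    and indep: "\<And>B C. B \<in> sets F \<Longrightarrow> C \<in> sets K \<Longrightarrow> prob (B \<inter> C \<inter> E) = 2 * prob (B \<inter> E) * prob (C \<inter> E)"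
    and Z: "Z \<in> sets (F \<Otimes>\<^sub>M K)"
  shows "(\<integral>\<^sup>+z. 2 * f (fst z) * g (snd z) * indicator Z z \<partial>(restr_to_subalg M F \<Otimes>\<^sub>M restr_to_subalg M K)) =
    emeasure M ({\<omega> \<in> space M. (\<omega>, \<omega>) \<in> Z} \<inter> E)"
proof -
  let ?F = "restr_to_subalg M F" and ?K = "restr_to_subalg M K"
  let ?N = "?F \<Otimes>\<^sub>M ?K"
  interpret F: prob_space ?F by (rule prob_space_restr_to_subalg[OF F prob_space_axioms])
  interpret K: prob_space ?K by (rule prob_space_restr_to_subalg[OF K prob_space_axioms])
  interpret N: pair_prob_space ?F ?K ..
  have sp[simp]: "space ?F = space M" "space ?K = space M" "space F = space M" "space K = space M"
    using F K by (auto simp: space_restr_to_subalg subalgebra_def)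
  have st: "sets ?F = sets F" "sets ?K = sets K" using F K by (auto simp: sets_restr_to_subalg)
  have stN: "sets ?N = sets (F \<Otimes>\<^sub>M K)" by (intro sets_pair_measure_cong st)
  have [measurable]: "f \<in> borel_measurable ?F" "g \<in> borel_measurable ?K"
    using f g st by (metis measurable_cong_sets)+
  have sub: "sets F \<subseteq> sets M" "sets K \<subseteq> sets M" using F K by (auto simp: subalgebra_def)
  have "(\<lambda>\<omega>. \<omega>) \<in> measurable M ?F" "(\<lambda>\<omega>. \<omega>) \<in> measurable M ?K"
    using sub sets.sets_into_space[of _ M] by (auto simp: measurable_def st Int_absorb2 subset_iff)
  then have phi: "(\<lambda>\<omega>. (\<omega>, \<omega>)) \<in> measurable M ?N" by (rule measurable_Pair)
  have [measurable]: "E \<in> sets M" by fact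
  \<comment> \<open>\<open>P1\<close> is the diagonal image of \<open>M\<close> restricted to
    \<open>E\<close>, and \<open>P2\<close> has the claimed density. Rectangles generate and are
    closed under intersection, so agreement of these finite measures on rectangles suffices.\<close>
  define P1 where "P1 = distr (density M (indicator E)) ?N (\<lambda>\<omega>. (\<omega>, \<omega>))"
  define P2 where "P2 = density ?N (\<lambda>z. 2 * f (fst z) * g (snd z))"
  have e1: "emeasure P1 Z = emeasure M ({\<omega> \<in> space M. (\<omega>, \<omega>) \<in> Z} \<inter> E)" if "Z \<in> sets ?N" for Z
  proof -
    have *: "{\<omega> \<in> space M. (\<omega>, \<omega>) \<in> Z} = (\<lambda>\<omega>. (\<omega>, \<omega>)) -` Z \<inter> space M" by auto
    have **: "(\<lambda>\<omega>. (\<omega>, \<omega>)) -` Z \<inter> space M \<in> sets M" by (rule measurable_sets[OF phi that])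
    have "emeasure P1 Z = emeasure (density M (indicator E)) ((\<lambda>\<omega>. (\<omega>, \<omega>)) -` Z \<inter> space M)"
      unfolding P1_def by (subst emeasure_distr[OF _ that]) (simp_all only: phi measurable_density_eq1 space_density)
    also have "\<dots> = (\<integral>\<^sup>+x. indicator E x * indicator ((\<lambda>\<omega>. (\<omega>, \<omega>)) -` Z \<inter> space M) x \<partial>M)"
      by (intro emeasure_density **) measurable
    also have "\<dots> = (\<integral>\<^sup>+x. indicator (((\<lambda>\<omega>. (\<omega>, \<omega>)) -` Z \<inter> space M) \<inter> E) x \<partial>M)"
      by (intro nn_integral_cong) (auto split: split_indicator)
    also have "\<dots> = emeasure M (((\<lambda>\<omega>. (\<omega>, \<omega>)) -` Z \<inter> space M) \<inter> E)"
      by (intro nn_integral_indicator sets.Int ** E)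
    finally show ?thesis using * by simp
  qed
  have e2: "emeasure P2 Z = (\<integral>\<^sup>+z. 2 * f (fst z) * g (snd z) * indicator Z z \<partial>?N)" if "Z \<in> sets ?N" for Z
    unfolding P2_def using that by (simp add: emeasure_density)
  have rect: "emeasure P1 (B \<times> C) = emeasure P2 (B \<times> C)" if B: "B \<in> sets F" and C: "C \<in> sets K" for B C
  proof -
    have BM: "B \<in> sets M" "C \<in> sets M" using sub B C by auto
    have [measurable]: "B \<in> sets ?F" "C \<in> sets ?K" using B C st by auto
    have "emeasure P2 (B \<times> C) = (\<integral>\<^sup>+z. 2 * f (fst z) * g (snd z) * indicator (B \<times> C) z \<partial>?N)"
      by (rule e2) measurable
    also have "\<dots> = (\<integral>\<^sup>+x. \<integral>\<^sup>+y. 2 * f x * g y * indicator (B \<times> C) (x, y) \<partial>?K \<partial>?F)"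
      by (subst K.nn_integral_fst[symmetric]) auto
    also have "\<dots> = (\<integral>\<^sup>+x. \<integral>\<^sup>+y. (2 * (f x * indicator B x)) * (g y * indicator C y) \<partial>?K \<partial>?F)"
      by (intro nn_integral_cong) (auto split: split_indicator simp: mult_ac)
    also have "\<dots> = (\<integral>\<^sup>+x. (2 * (f x * indicator B x)) * (\<integral>\<^sup>+y. g y * indicator C y \<partial>?K) \<partial>?F)"
      by (intro nn_integral_cong nn_integral_cmult) measurable
    also have "\<dots> = (\<integral>\<^sup>+x. (2 * (f x * indicator B x)) \<partial>?F) * (\<integral>\<^sup>+y. g y * indicator C y \<partial>?K)"
      by (intro nn_integral_multc) measurable
    also have "(\<integral>\<^sup>+x. (2 * (f x * indicator B x)) \<partial>?F) = 2 * (\<integral>\<^sup>+x. f x * indicator B x \<partial>?F)"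
      by (intro nn_integral_cmult) measurable
    also have "(\<integral>\<^sup>+x. f x * indicator B x \<partial>?F) = (\<integral>\<^sup>+x. f x * indicator B x \<partial>M)"
      using f B by (intro nn_integral_subalgebra2[OF F]) auto
    also have "(\<integral>\<^sup>+x. g x * indicator C x \<partial>?K) = (\<integral>\<^sup>+x. g x * indicator C x \<partial>M)"
      using g C by (intro nn_integral_subalgebra2[OF K]) auto
    also have "2 * (\<integral>\<^sup>+x. f x * indicator B x \<partial>M) * (\<integral>\<^sup>+x. g x * indicator C x \<partial>M) =
       ennreal (2 * prob (B \<inter> E) * prob (C \<inter> E))"
      by (simp add: fE gE B C emeasure_eq_measure ennreal_mult'')
    also have "\<dots> = emeasure M (B \<inter> C \<inter> E)" by (simp add: indep[OF B C] emeasure_eq_measure)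
    also have "B \<inter> C = {\<omega> \<in> space M. (\<omega>, \<omega>) \<in> B \<times> C}" using sets.sets_into_space[OF BM(1)] by auto
    also have "emeasure M ({\<omega> \<in> space M. (\<omega>, \<omega>) \<in> B \<times> C} \<inter> E) = emeasure P1 (B \<times> C)"
      by (intro e1[symmetric]) measurable
    finally show ?thesis by simp
  qed
  have "P1 = P2"
  proof (rule measure_eqI_generator_eq)
    let ?R = "{a \<times> b |a b. a \<in> sets F \<and> b \<in> sets K}" and ?O = "space M \<times> space M"
    show "Int_stable ?R" using Int_stable_pair_measure_generator[of F K] by simp
    show "?R \<subseteq> Pow ?O" using pair_measure_closed[of F K] by simp
    show "sets P1 = sigma_sets ?O ?R" "sets P2 = sigma_sets ?O ?R"
      using stN by (simp_all add: P1_def P2_def sets_pair_measure)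
    show "emeasure P1 X = emeasure P2 X" if "X \<in> ?R" for X using that rect by auto
    show "range (\<lambda>i::nat. ?O) \<subseteq> ?R" using sets.top[of F] sets.top[of K] by force
    show "(\<Union>i::nat. ?O) = ?O" by simp
    show "emeasure P1 ?O \<noteq> \<infinity>" for i :: nat
      by (subst e1) (use sets.top[of ?N] in \<open>auto simp: space_pair_measure emeasure_eq_measure\<close>)
  qed
  then show ?thesis using e1[of Z] e2[of Z] Z unfolding stN by simp
qed

text \<open>Clamping the conditional expectation to the unit interval changes it on a null set only.
  Then \<open>q\<close> and \<open>1 - q\<close> are both non-negative everywhere and survive the
  passage to \<open>ennreal\<close> as densities of \<open>E\<close> and of its complement.\<close>

lemma (in prob_space) cond_exp_indicator_version:
  assumes F: "subalgebra M F" and E: "E \<in> events"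
  obtains q :: "'a \<Rightarrow> real" where "q \<in> borel_measurable F" "\<And>x. 0 \<le> q x" "\<And>x. q x \<le> 1"
    "AE x in M. q x = real_cond_exp M F (indicator E) x"
    "\<And>B. B \<in> sets F \<Longrightarrow> (\<integral>\<^sup>+x. ennreal (q x) * indicator B x \<partial>M) = emeasure M (B \<inter> E)"
    "\<And>B. B \<in> sets F \<Longrightarrow> (\<integral>\<^sup>+x. ennreal (1 - q x) * indicator B x \<partial>M) = emeasure M (B \<inter> (space M - E))"
proof -
  interpret F: finite_measure_subalgebra M F by standard (rule F)
  have [measurable]: "E \<in> sets M" by fact
  let ?r = "real_cond_exp M F (indicator E)"
  define q where "q x = max 0 (min 1 (?r x))" for x
  have qF: "q \<in> borel_measurable F" unfolding q_def by measurable
  then have [measurable]: "q \<in> borel_measurable M" by (rule measurable_from_subalg[OF F])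
  have q01: "0 \<le> q x" "q x \<le> 1" for x by (auto simp: q_def)
  have int_E: "integrable M (indicator E :: 'a \<Rightarrow> real)" by (auto simp: emeasure_eq_measure)
  have "AE x in M. 0 \<le> ?r x" by (intro F.real_cond_exp_ge_c int_E) auto
  moreover have "AE x in M. ?r x \<le> 1" by (intro F.real_cond_exp_le_c int_E) (auto simp: indicator_def)
  ultimately have ae: "AE x in M. q x = ?r x" by eventually_elim (auto simp: q_def)
  have int1: "(\<integral>x. q x * indicator B x \<partial>M) = prob (B \<inter> E)" if B: "B \<in> sets F" for B
  proof -
    have [measurable]: "B \<in> sets M" using B F by (auto simp: subalgebra_def)
    have "(\<integral>x. q x * indicator B x \<partial>M) = (\<integral>x. indicator B x * ?r x \<partial>M)"
      using ae by (intro integral_cong_AE) auto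
    also have "\<dots> = (\<integral>x. indicator B x * indicator E x \<partial>M)"
      using B by (intro F.real_cond_exp_intg integrable_const_bound[of _ 1]) (auto split: split_indicator)
    also have "\<dots> = (\<integral>x. indicator (B \<inter> E) x \<partial>M)" by (simp add: indicator_inter_arith)
    also have "\<dots> = prob (B \<inter> E)" by simp
    finally show ?thesis .
  qed
  have nn: "(\<integral>\<^sup>+x. ennreal (h x) * indicator B x \<partial>M) = ennreal (\<integral>x. h x * indicator B x \<partial>M)"
    if "B \<in> sets F" "h \<in> borel_measurable M" "\<And>x. 0 \<le> h x" "\<And>x. h x \<le> 1" for h :: "'a \<Rightarrow> real" and B
  proof -
    have [measurable]: "B \<in> sets M" "h \<in> borel_measurable M" using that F by (auto simp: subalgebra_def)
    have "(\<integral>\<^sup>+x. ennreal (h x) * indicator B x \<partial>M) = (\<integral>\<^sup>+x. ennreal (h x * indicator B x) \<partial>M)"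
      by (intro nn_integral_cong) (auto split: split_indicator)
    also have "\<dots> = ennreal (\<integral>x. h x * indicator B x \<partial>M)"
      using that by (intro nn_integral_eq_integral integrable_const_bound[of _ 1])
        (auto split: split_indicator)
    finally show ?thesis .
  qed
  show ?thesis
  proof
    fix B assume B: "B \<in> sets F"
    have BM[measurable]: "B \<in> sets M" using B F by (auto simp: subalgebra_def)
    show "(\<integral>\<^sup>+x. ennreal (q x) * indicator B x \<partial>M) = emeasure M (B \<inter> E)"
      using nn[OF B _ q01] int1[OF B] by (simp add: emeasure_eq_measure)
    have "(\<integral>x. (1 - q x) * indicator B x \<partial>M) = (\<integral>x. indicator B x - q x * indicator B x \<partial>M)"
      by (simp add: algebra_simps)
    also have "\<dots> = prob B - prob (B \<inter> E)"
      by (subst Bochner_Integration.integral_diff)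
        (auto simp: int1[OF B] emeasure_eq_measure q01 intro!: integrable_const_bound[of _ 1] split: split_indicator)
    also have "\<dots> = prob (B \<inter> (space M - E))"
      using finite_measure_Diff'[of B E] sets.sets_into_space[OF BM] by (simp add: Int_Diff[symmetric] Int_absorb2)
    finally show "(\<integral>\<^sup>+x. ennreal (1 - q x) * indicator B x \<partial>M) = emeasure M (B \<inter> (space M - E))"
      using nn[OF B, of "\<lambda>x. 1 - q x"] q01 by (simp add: emeasure_eq_measure)
  qed (use qF q01 ae in auto)
qed

text \<open>
  With \<open>q = P[E | F]\<close> and \<open>p = P[E | K]\<close>, the densities on \<open>E\<close> and on its complement are
  \<open>2 q p\<close> and \<open>2 (1 - q) (1 - p)\<close>. They agree only where \<open>q + p = 1\<close>.
\<close>

lemma (in prob_space) posterior_half_null: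
  assumes F: "subalgebra M F" and K: "subalgebra M K" and E: "E \<in> events"
    and indep1: "\<And>B C. B \<in> sets F \<Longrightarrow> C \<in> sets K \<Longrightarrow> prob (B \<inter> C \<inter> E) = 2 * prob (B \<inter> E) * prob (C \<inter> E)"
    and indep0: "\<And>B C. B \<in> sets F \<Longrightarrow> C \<in> sets K \<Longrightarrow>
      prob (B \<inter> C \<inter> (space M - E)) = 2 * prob (B \<inter> (space M - E)) * prob (C \<inter> (space M - E))"
    and no_atoms: "\<And>x. AE \<omega> in M. real_cond_exp M F (indicator E) \<omega> \<noteq> x"
    and T: "T \<in> sigma_sets (space M) (sets F \<union> sets K)"
    and half: "\<And>Z. Z \<in> sigma_sets (space M) (sets F \<union> sets K) \<Longrightarrow> Z \<subseteq> T \<Longrightarrow>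
      prob (Z \<inter> E) = prob (Z \<inter> (space M - E))"
  shows "prob T = 0"
proof -
  let ?F = "restr_to_subalg M F" and ?K = "restr_to_subalg M K"
  let ?N = "?F \<Otimes>\<^sub>M ?K" and ?E' = "space M - E"
  interpret F: prob_space ?F by (rule prob_space_restr_to_subalg[OF F prob_space_axioms])
  interpret K: prob_space ?K by (rule prob_space_restr_to_subalg[OF K prob_space_axioms])
  interpret N: pair_prob_space ?F ?K ..
  have sp: "space ?F = space M" "space ?K = space M" "space F = space M" "space K = space M"
    using F K by (auto simp: space_restr_to_subalg subalgebra_def)
  have st: "sets ?F = sets F" "sets ?K = sets K" using F K by (auto simp: sets_restr_to_subalg)
  have stN: "sets ?N = sets (F \<Otimes>\<^sub>M K)" by (intro sets_pair_measure_cong st)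
  have sub: "sets F \<subseteq> sets M" "sets K \<subseteq> sets M" using F K by (auto simp: subalgebra_def)
  obtain q where q: "q \<in> borel_measurable F" "\<And>x. 0 \<le> q x" "\<And>x. q x \<le> 1"
    "AE x in M. q x = real_cond_exp M F (indicator E) x"
    "\<And>B. B \<in> sets F \<Longrightarrow> (\<integral>\<^sup>+x. ennreal (q x) * indicator B x \<partial>M) = emeasure M (B \<inter> E)"
    "\<And>B. B \<in> sets F \<Longrightarrow> (\<integral>\<^sup>+x. ennreal (1 - q x) * indicator B x \<partial>M) = emeasure M (B \<inter> ?E')"
    by (rule cond_exp_indicator_version[OF F E]) (rule that)
  obtain p where p: "p \<in> borel_measurable K" "\<And>x. 0 \<le> p x" "\<And>x. p x \<le> 1"
    "AE x in M. p x = real_cond_exp M K (indicator E) x"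
    "\<And>B. B \<in> sets K \<Longrightarrow> (\<integral>\<^sup>+x. ennreal (p x) * indicator B x \<partial>M) = emeasure M (B \<inter> E)"
    "\<And>B. B \<in> sets K \<Longrightarrow> (\<integral>\<^sup>+x. ennreal (1 - p x) * indicator B x \<partial>M) = emeasure M (B \<inter> ?E')"
    by (rule cond_exp_indicator_version[OF K E]) (rule that)
  have [measurable]: "q \<in> borel_measurable ?F" "p \<in> borel_measurable ?K"
    using q(1) p(1) st by (metis measurable_cong_sets)+
  let ?d = "\<lambda>Z. {\<omega> \<in> space M. (\<omega>, \<omega>) \<in> Z}"
  define f where "f z = 2 * ennreal (q (fst z)) * ennreal (p (snd z))" for z
  define f' where "f' z = 2 * ennreal (1 - q (fst z)) * ennreal (1 - p (snd z))" for z
  have [measurable]: "f \<in> borel_measurable ?N" "f' \<in> borel_measurable ?N"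
    unfolding f_def f'_def by measurable
  have dE: "(\<integral>\<^sup>+z. f z * indicator Z z \<partial>?N) = emeasure M (?d Z \<inter> E)" if "Z \<in> sets ?N" for Z
    unfolding f_def using that stN q(1) p(1)
    by (intro density_of_cond_indep[OF F K E _ _ q(5) p(5) indep1]) auto
  have dE': "(\<integral>\<^sup>+z. f' z * indicator Z z \<partial>?N) = emeasure M (?d Z \<inter> ?E')" if "Z \<in> sets ?N" for Z
    unfolding f'_def using that stN q(1) p(1) E
    by (intro density_of_cond_indep[OF F K _ _ _ q(6) p(6) indep0]) auto
  define \<Sigma> where "\<Sigma> = sigma_sets (space M) (sets F \<union> sets K)"
  have dpre: "?d Z = (\<lambda>\<omega>. (\<omega>, \<omega>)) -` Z \<inter> space M" for Z by auto
  have gen: "sets F \<union> sets K \<subseteq> Pow (space M)" using sub sets.sets_into_space by blast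
  have "(\<lambda>\<omega>. \<omega>) \<in> measurable (sigma (space M) (sets F \<union> sets K)) F"
    using sets.sets_into_space[of _ F] sp gen
    by (intro measurableI) (auto simp: Int_absorb2 sets_measure_of intro: sigma_sets.Basic)
  moreover have "(\<lambda>\<omega>. \<omega>) \<in> measurable (sigma (space M) (sets F \<union> sets K)) K"
    using sets.sets_into_space[of _ K] sp gen
    by (intro measurableI) (auto simp: Int_absorb2 sets_measure_of intro: sigma_sets.Basic)
  ultimately have phi: "(\<lambda>\<omega>. (\<omega>, \<omega>)) \<in> measurable (sigma (space M) (sets F \<union> sets K)) (F \<Otimes>\<^sub>M K)"
    by (rule measurable_Pair)
  have d\<Sigma>: "?d Z \<in> \<Sigma>" if "Z \<in> sets ?N" for Z
    using measurable_sets[OF phi] that gen unfolding dpre \<Sigma>_def stN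
    by (auto simp: sets_measure_of space_measure_of)
  \<comment> \<open>Events of the joint sigma-algebra are the diagonal preimages of product events,
    so \<open>T\<close> and its sub-events can be studied on the product space.\<close>
  have rep: "\<exists>Z\<in>sets ?N. R = ?d Z" if "R \<in> \<Sigma>" for R
    using that unfolding \<Sigma>_def
  proof induction
    case (Basic a)
    then show ?case
    proof
      assume a: "a \<in> sets F"
      then have "a \<times> space M \<in> sets ?N" using sets.top[of ?K] st sp by auto
      moreover have "a = ?d (a \<times> space M)" using sets.sets_into_space[OF a] sp by auto
      ultimately show ?thesis by blast
    next
      assume a: "a \<in> sets K"
      then have "space M \<times> a \<in> sets ?N" using sets.top[of ?F] st sp by auto
      moreover have "a = ?d (space M \<times> a)" using sets.sets_into_space[OF a] sp by auto
      ultimately show ?thesis by blast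
    qed
  next
    case Empty then show ?case by (intro bexI[of _ "{}"]) auto
  next
    case (Compl a)
    then obtain Z where "Z \<in> sets ?N" "a = ?d Z" by blast
    moreover have "space M - ?d Z = ?d (space ?N - Z)" by (auto simp: space_pair_measure sp)
    ultimately show ?case using sets.compl_sets[of Z ?N] by blast
  next
    case (Union a)
    then have "\<forall>i. \<exists>Z. Z \<in> sets ?N \<and> a i = ?d Z" by blast
    from choice[OF this] obtain Z where Z: "\<And>i. Z i \<in> sets ?N" "\<And>i. a i = ?d (Z i)" by auto
    have "\<Union> (range a) = ?d (\<Union> (range Z))" unfolding Z(2) by auto
    moreover have "\<Union> (range Z) \<in> sets ?N" using Z(1) by auto
    ultimately show ?case by blast
  qed
  then obtain T' where T'[measurable]: "T' \<in> sets ?N" and TT': "T = ?d T'" using T \<Sigma>_def by blast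
  \<comment> \<open>By \<open>half\<close>, the two densities have equal integrals over every
    measurable piece of \<open>T'\<close>.\<close>
  have "AE z in ?N. f z * indicator T' z = f' z * indicator T' z"
  proof (rule N.P.density_unique_finite_measure)
    fix A assume [measurable]: "A \<in> sets ?N"
    have "(\<integral>\<^sup>+z. f z * indicator T' z * indicator A z \<partial>?N) = (\<integral>\<^sup>+z. f z * indicator (T' \<inter> A) z \<partial>?N)"
      by (intro nn_integral_cong) (auto split: split_indicator)
    also have "\<dots> = (\<integral>\<^sup>+z. f' z * indicator (T' \<inter> A) z \<partial>?N)"
      using half[of "?d (T' \<inter> A)"] d\<Sigma>[of "T' \<inter> A"] TT' \<Sigma>_def
      by (subst dE, simp, subst dE', simp) (auto simp: emeasure_eq_measure)
    also have "\<dots> = (\<integral>\<^sup>+z. f' z * indicator T' z * indicator A z \<partial>?N)"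
      by (intro nn_integral_cong) (auto split: split_indicator)
    finally show "(\<integral>\<^sup>+z. f z * indicator T' z * indicator A z \<partial>?N) =
      (\<integral>\<^sup>+z. f' z * indicator T' z * indicator A z \<partial>?N)" .
  qed auto
  \<comment> \<open>Under the product measure the two coordinates are independent without
    conditioning, so Fubini applies: for fixed \<open>y\<close> the section asks \<open>q\<close> to
    take the single value \<open>1 - p y\<close>, which has probability 0.\<close>
  moreover have "AE z in ?N. q (fst z) + p (snd z) \<noteq> 1"
  proof -
    let ?B = "{z \<in> space ?N. q (fst z) + p (snd z) = 1}"
    have B[measurable]: "?B \<in> sets ?N" by measurable
    have "emeasure ?F ((\<lambda>x. (x, y)) -` ?B) = 0" if "y \<in> space ?K" for y
    proof -
      have s: "(\<lambda>x. (x, y)) -` ?B \<in> sets ?F" by (rule sets_Pair2[OF B])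
      then have s': "(\<lambda>x. (x, y)) -` ?B \<in> sets M" using sub st by auto
      have "AE x in M. x \<notin> (\<lambda>x. (x, y)) -` ?B"
        using no_atoms[of "1 - p y"] q(4) by eventually_elim auto
      then have "emeasure M ((\<lambda>x. (x, y)) -` ?B) = 0" using s' by (simp add: AE_iff_null_sets null_setsD1)
      then show ?thesis using s st by (simp add: emeasure_restr_to_subalg[OF F])
    qed
    then have "emeasure ?N ?B = 0"
      by (subst N.emeasure_pair_measure_alt2[OF B]) (simp add: nn_integral_0_iff_AE cong: nn_integral_cong)
    then show ?thesis by (subst AE_iff_measurable[OF B]) auto
  qed
  ultimately have "AE z in ?N. f z * indicator T' z = 0"
  proof eventually_elim
    case (elim z)
    have twice: "2 * ennreal a * ennreal b = ennreal (2 * a * b)" if "0 \<le> a" "0 \<le> b" for a b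
      using that by (simp add: ennreal_mult)
    have "f z \<noteq> f' z"
    proof
      assume "f z = f' z"
      then have "ennreal (2 * q (fst z) * p (snd z)) = ennreal (2 * (1 - q (fst z)) * (1 - p (snd z)))"
        unfolding f_def f'_def using q(2,3) p(2,3) by (simp only: twice diff_ge_0_iff_ge)
      then have "2 * q (fst z) * p (snd z) = 2 * (1 - q (fst z)) * (1 - p (snd z))"
        using q(2,3) p(2,3) by (subst (asm) ennreal_inj) auto
      with elim(2) show False by (simp add: algebra_simps)
    qed
    with elim(1) show ?case by (auto split: split_indicator)
  qed
  then have "(\<integral>\<^sup>+z. f z * indicator T' z \<partial>?N) = 0" by (subst nn_integral_0_iff_AE) auto
  then have "prob (T \<inter> E) = 0" using dE[OF T'] TT' by (simp add: measure_def)
  moreover have "prob (T \<inter> E) = prob (T \<inter> ?E')" using half[OF T] by simp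
  moreover have TM: "T \<in> sets M"
    using T sub sets.sigma_sets_subset[of "sets F \<union> sets K" M] by auto
  have "prob ((T \<inter> E) \<union> (T \<inter> ?E')) = prob (T \<inter> E) + prob (T \<inter> ?E')"
    using TM E by (intro finite_measure_Union) auto
  moreover have "(T \<inter> E) \<union> (T \<inter> ?E') = T" using sets.sets_into_space[OF TM] by auto
  ultimately show ?thesis by simp
qed

section \<open>Independence of coordinates under a product measure\<close>

lemma (in product_prob_space) indep_vars_coordinates:
  assumes "I \<noteq> {}"
  shows "P.indep_vars M (\<lambda>i x. x i) I"
proof -
  have "distr (Pi\<^sub>M I M) (Pi\<^sub>M I M) (\<lambda>x. \<lambda>i\<in>I. x i) = distr (Pi\<^sub>M I M) (Pi\<^sub>M I M) (\<lambda>x. x)"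
    by (rule distr_cong) (auto simp: space_PiM PiE_def extensional_restrict)
  also have "\<dots> = Pi\<^sub>M I M" by (rule distr_id2) simp
  also have "\<dots> = Pi\<^sub>M I (\<lambda>i. distr (Pi\<^sub>M I M) (M i) (\<lambda>x. x i))"
    by (rule PiM_cong) (simp_all add: PiM_component)
  finally show ?thesis
    by (subst P.indep_vars_iff_distr_eq_PiM'[OF assms]) auto
qed

text \<open>Independence of all coordinates passes to the sigma-algebras generated by disjoint
  groups of them. The two groups, \<open>{u}\<close> and \<open>I - {u}\<close>, are indexed by
  \<open>bool\<close>.\<close>

lemma (in product_prob_space) indep_coordinate_others:
  assumes u: "u \<in> I" and B: "B \<in> sets (M u)"
    and C: "C \<in> sigma_sets (space (Pi\<^sub>M I M)) (\<Union>v\<in>I - {u}. {(\<lambda>x. x v) -` B \<inter> space (Pi\<^sub>M I M) |B. B \<in> sets (M v)})"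
  shows "P.prob (((\<lambda>x. x u) -` B \<inter> space (Pi\<^sub>M I M)) \<inter> C) =
    P.prob ((\<lambda>x. x u) -` B \<inter> space (Pi\<^sub>M I M)) * P.prob C"
proof -
  let ?G = "\<lambda>v. {(\<lambda>x. x v) -` B \<inter> space (Pi\<^sub>M I M) |B. B \<in> sets (M v)}"
  let ?J = "case_bool {u} (I - {u})"
  have un: "(\<Union>j\<in>UNIV. ?J j) = I" using u by (auto simp: UNIV_bool)
  have "P.indep_sets ?G I"
    using indep_vars_coordinates u unfolding P.indep_vars_def2 by auto
  then have "P.indep_sets (\<lambda>j. sigma_sets (space (Pi\<^sub>M I M)) (\<Union>i\<in>?J j. ?G i)) UNIV"
  proof (intro P.indep_sets_collect_sigma)
    show "P.indep_sets ?G (\<Union>j\<in>UNIV. ?J j)" if "P.indep_sets ?G I" using that un by simp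
    show "Int_stable (?G i)" for i
    proof (rule Int_stableI)
      fix a b assume "a \<in> ?G i" "b \<in> ?G i"
      then obtain A B where "A \<in> sets (M i)" "a = (\<lambda>x. x i) -` A \<inter> space (Pi\<^sub>M I M)"
        "B \<in> sets (M i)" "b = (\<lambda>x. x i) -` B \<inter> space (Pi\<^sub>M I M)" by blast
      then show "a \<inter> b \<in> ?G i" by (intro CollectI exI[of _ "A \<inter> B"]) auto
    qed
    show "disjoint_family_on ?J UNIV" by (auto simp: disjoint_family_on_def split: bool.splits)
  qed
  moreover have "(\<lambda>j. sigma_sets (space (Pi\<^sub>M I M)) (\<Union>i\<in>?J j. ?G i)) =
    case_bool (sigma_sets (space (Pi\<^sub>M I M)) (?G u)) (sigma_sets (space (Pi\<^sub>M I M)) (\<Union>v\<in>I - {u}. ?G v))"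
    by (auto simp: fun_eq_iff split: bool.splits)
  ultimately have "P.indep_set (sigma_sets (space (Pi\<^sub>M I M)) (?G u)) (sigma_sets (space (Pi\<^sub>M I M)) (\<Union>v\<in>I - {u}. ?G v))"
    unfolding P.indep_set_def by simp
  then show ?thesis by (rule P.indep_setD) (use B C in \<open>auto intro!: sigma_sets.Basic\<close>)
qed

section \<open>Information and the gain of an event\<close>

sublocale social_learning \<subseteq> prob_space M by (rule prob_space_M)

context social_learning
begin

abbreviation "Info \<equiv> information M \<mu>0 G W A"
abbreviation "Lim_info \<equiv> limit_information M \<mu>0 G W A"
abbreviation "belief u \<equiv> posterior M S (Lim_info u)"

definition "state1 = {\<omega> \<in> space M. S \<omega> = 1}"
definition "state0 = space M - state1"

definition "observations u t = {W u -` B \<inter> space M |B. B \<in> sets \<mu>0} \<union>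
  {A v t' -` C \<inter> space M |v t' C. (u, v) \<in> parcs G \<and> 1 \<le> t' \<and> t' < t}"

lemma arc_agents:
  assumes "(u, v) \<in> parcs G"
  shows "u \<in> pverts G" "v \<in> pverts G" "u \<noteq> v"
  using pair_loopfree_digraph.pair_no_loops[OF simple_network assms]
    pair_wf_digraph.in_arcsD1[OF pair_loopfree_digraph.axioms(1)[OF simple_network] assms]
    pair_wf_digraph.in_arcsD2[OF pair_loopfree_digraph.axioms(1)[OF simple_network] assms]
  by auto

lemma observations_subset: "observations u t \<subseteq> Pow (space M)"
  by (auto simp: observations_def)

lemma space_Info[simp]: "space (Info u t) = space M"
  using observations_subset[of u t] by (simp add: information_def space_measure_of_conv)

lemma sets_Info: "sets (Info u t) = sigma_sets (space M) (observations u t)"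
  using observations_subset[of u t] unfolding information_def observations_def[symmetric]
  by (rule sets_measure_of)

lemma space_Lim_info[simp]: "space (Lim_info u) = space M"
  by (simp add: limit_information_def space_measure_of_conv)

lemma sets_Lim_info: "sets (Lim_info u) = sigma_sets (space M) (\<Union>t\<in>{1..}. sets (Info u t))"
  unfolding limit_information_def
  by (rule sets_measure_of) (use sets.sets_into_space[of _ "Info u _"] in auto)

lemma action_in_Info:
  assumes "u \<in> pverts G" "1 \<le> t"
  shows "A u t -` C \<inter> space M \<in> sets (Info u t)"
proof -
  have "A u t -` (C \<inter> {0, 1}) \<inter> space (Info u t) \<in> sets (Info u t)"
    using action_measurable[OF assms] by (rule measurable_sets) auto
  moreover have "A u t \<omega> \<in> {0, 1}" if "\<omega> \<in> space M" for \<omega>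
    using measurable_space[OF action_measurable[OF assms]] that by auto
  then have "A u t -` C \<inter> space M = A u t -` (C \<inter> {0, 1}) \<inter> space (Info u t)" by auto
  ultimately show ?thesis by simp
qed

lemma action_01: "u \<in> pverts G \<Longrightarrow> 1 \<le> t \<Longrightarrow> \<omega> \<in> space M \<Longrightarrow> A u t \<omega> = 0 \<or> A u t \<omega> = 1"
  using measurable_space[OF action_measurable, of u t \<omega>] by auto

text \<open>Information refers to actions of others, and these are known to be measurable only
  relative to the information of their agents. Since only earlier actions are observed, strong
  induction on time, with the agent arbitrary, resolves the circularity.\<close>

lemma Info_events: "u \<in> pverts G \<Longrightarrow> sets (Info u t) \<subseteq> events"
proof (induction t arbitrary: u rule: less_induct)
  case (less t)
  have "observations u t \<subseteq> events"
  proof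
    fix x assume "x \<in> observations u t"
    then consider B where "x = W u -` B \<inter> space M" "B \<in> sets \<mu>0"
      | v t' C where "x = A v t' -` C \<inter> space M" "(u, v) \<in> parcs G" "1 \<le> t'" "t' < t"
      by (auto simp: observations_def)
    then show "x \<in> events"
    proof cases
      case 1 then show ?thesis using measurable_sets[OF signal_measurable[OF less(2)]] by auto
    next
      case 2
      then show ?thesis using action_in_Info[of v t' C] arc_agents[of u v] less(1)[of t' v] by auto
    qed
  qed
  then show ?case unfolding sets_Info by (rule sets.sigma_sets_subset)
qed

lemma Info_mono: "s \<le> t \<Longrightarrow> sets (Info u s) \<subseteq> sets (Info u t)"
  unfolding sets_Info by (intro sigma_sets_mono') (force simp: observations_def)

lemma Info_subset_Lim_info: "1 \<le> t \<Longrightarrow> sets (Info u t) \<subseteq> sets (Lim_info u)"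
  unfolding sets_Lim_info by auto

lemma subalgebra_Info: "u \<in> pverts G \<Longrightarrow> subalgebra M (Info u t)"
  using Info_events by (simp add: subalgebra_def)

lemma Lim_info_events: "u \<in> pverts G \<Longrightarrow> sets (Lim_info u) \<subseteq> events"
  unfolding sets_Lim_info using Info_events by (intro sets.sigma_sets_subset) auto

lemma subalgebra_Lim_info: "u \<in> pverts G \<Longrightarrow> subalgebra M (Lim_info u)"
  using Lim_info_events by (simp add: subalgebra_def)

lemma state_events[measurable]: "state1 \<in> events" "state0 \<in> events"
proof -
  have "S -` {1} \<inter> space M \<in> events" using state_measurable by (rule measurable_sets) auto
  moreover have "S -` {1} \<inter> space M = state1" by (auto simp: state1_def)
  ultimately show "state1 \<in> events" by simp
  then show "state0 \<in> events" by (auto simp: state0_def)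
qed

lemma posterior_eq: "posterior M S F = real_cond_exp M F (indicator state1)"
  by (simp add: posterior_def state1_def)

lemma prob_state0: "Q \<in> events \<Longrightarrow> prob (Q \<inter> state0) = prob Q - prob (Q \<inter> state1)"
  using finite_measure_Diff'[of Q state1] sets.sets_into_space[of Q M]
  by (simp add: state0_def Int_Diff[symmetric] Int_absorb2)

section \<open>Gain as a signed measure\<close>

text \<open>Guessing 1 on \<open>Q\<close> and 0 off \<open>Q\<close> is correct with probability
  \<open>gain Q + prob state0\<close>. Subtracting this constant gives a signed measure, so
  improvements can be computed piece by piece.\<close>

definition "gain Q = prob (Q \<inter> state1) - prob (Q \<inter> state0)"

lemma gain_disjoint_Un:
  assumes "Q \<in> events" "R \<in> events" "Q \<inter> R = {}"
  shows "gain (Q \<union> R) = gain Q + gain R"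
proof -
  have "prob ((Q \<union> R) \<inter> E) = prob (Q \<inter> E) + prob (R \<inter> E)" if "E \<in> events" for E
    unfolding Int_Un_distrib2 using assms that by (intro finite_measure_Union) auto
  then show ?thesis by (simp add: gain_def)
qed

lemma gain_Diff:
  assumes "Q \<in> events" "R \<in> events"
  shows "gain (Q - R) - gain (R - Q) = gain Q - gain R"
proof -
  have "gain P = gain (P - P') + gain (P \<inter> P')" if "P \<in> events" "P' \<in> events" for P P'
  proof -
    have "(P - P') \<union> (P \<inter> P') = P" by auto
    then show ?thesis using gain_disjoint_Un[of "P - P'" "P \<inter> P'"] that by auto
  qed
  from this[OF assms] this[OF assms(2,1)] show ?thesis by (simp add: Int_commute)
qed

lemma abs_gain_le:
  assumes "Q \<in> events" shows "\<bar>gain Q\<bar> \<le> prob Q"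
proof -
  have "0 \<le> prob (Q \<inter> state1)" "0 \<le> prob (Q \<inter> state0)" by simp_all
  then show ?thesis using prob_state0[OF assms] unfolding gain_def by linarith
qed

lemma gain_incseq:
  assumes "range Q \<subseteq> events" "incseq Q"
  shows "(\<lambda>n. gain (Q n)) \<longlonglongrightarrow> gain (\<Union>n. Q n)"
proof -
  have "(\<lambda>n. prob (Q n \<inter> E)) \<longlonglongrightarrow> prob ((\<Union>n. Q n) \<inter> E)" if "E \<in> events" for E
    using finite_Lim_measure_incseq[of "\<lambda>n. Q n \<inter> E"] assms that by (auto simp: incseq_def)
  then show ?thesis unfolding gain_def by (intro tendsto_diff) auto
qed

lemma gain_decseq:
  assumes "range Q \<subseteq> events" "decseq Q"
  shows "(\<lambda>n. gain (Q n)) \<longlonglongrightarrow> gain (\<Inter>n. Q n)"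
proof -
  have "(\<lambda>n. prob (Q n \<inter> E)) \<longlonglongrightarrow> prob ((\<Inter>n. Q n) \<inter> E)" if "E \<in> events" for E
    using finite_Lim_measure_decseq[of "\<lambda>n. Q n \<inter> E"] assms that by (auto simp: decseq_def)
  then show ?thesis unfolding gain_def by (intro tendsto_diff) auto
qed

text \<open>On the events of \<open>F\<close>, the mass of \<open>Q\<close> in state 1 is the
  integral of the posterior over \<open>Q\<close>, and the mass in state 0 that of its complement to
  1. Hence \<open>2 * posterior - 1\<close> is the density of \<open>gain\<close> on
  \<open>F\<close>.\<close>

lemma
  assumes F: "subalgebra M F" and Q: "Q \<in> sets F"
  shows gain_eq_integral: "gain Q = (\<integral>\<omega>. indicator Q \<omega> * (2 * posterior M S F \<omega> - 1) \<partial>M)"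
    and integrable_posterior: "integrable M (\<lambda>\<omega>. indicator Q \<omega> * (2 * posterior M S F \<omega> - 1))"
proof -
  interpret F: finite_measure_subalgebra M F by standard (rule F)
  have QM[measurable]: "Q \<in> events" using F Q by (auto simp: subalgebra_def)
  have int: "integrable M (posterior M S F)"
    unfolding posterior_eq by (intro F.real_cond_exp_int) (auto simp: emeasure_eq_measure)
  have int': "integrable M (\<lambda>\<omega>. indicator Q \<omega> * posterior M S F \<omega>)"
    using integrable_real_mult_indicator[OF QM int] by (simp add: mult.commute)
  have "(\<integral>\<omega>. indicator Q \<omega> * posterior M S F \<omega> \<partial>M) = (\<integral>\<omega>. indicator Q \<omega> * indicator state1 \<omega> \<partial>M)"
    unfolding posterior_eq using Q
    by (intro F.real_cond_exp_intg integrable_const_bound[of _ 1]) (auto split: split_indicator)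
  also have "\<dots> = (\<integral>\<omega>. indicator (Q \<inter> state1) \<omega> \<partial>M)" by (simp add: indicator_inter_arith)
  also have "\<dots> = prob (Q \<inter> state1)" by simp
  finally have *: "(\<integral>\<omega>. indicator Q \<omega> * posterior M S F \<omega> \<partial>M) = prob (Q \<inter> state1)" .
  have intQ: "integrable M (indicator Q :: 'a \<Rightarrow> real)" by (auto simp: emeasure_eq_measure)
  have eq: "indicator Q \<omega> * (2 * posterior M S F \<omega> - 1) =
      2 * (indicator Q \<omega> * posterior M S F \<omega>) - indicator Q \<omega>" for \<omega>
    by (simp add: algebra_simps)
  show "integrable M (\<lambda>\<omega>. indicator Q \<omega> * (2 * posterior M S F \<omega> - 1))"
    unfolding eq using int' intQ by auto
  have "(\<integral>\<omega>. indicator Q \<omega> * (2 * posterior M S F \<omega> - 1) \<partial>M) = 2 * prob (Q \<inter> state1) - prob Q"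
    unfolding eq using int' intQ * by (subst Bochner_Integration.integral_diff) auto
  then show "gain Q = (\<integral>\<omega>. indicator Q \<omega> * (2 * posterior M S F \<omega> - 1) \<partial>M)"
    by (simp add: gain_def prob_state0)
qed

text \<open>The set where the density \<open>2 * posterior - 1\<close> is positive collects all of
  its positive part and none of its negative part. If \<open>Q\<close> does equally well, the
  non-negative difference \<open>?h\<close> has integral 0 and vanishes almost everywhere; ties
  contribute nothing, so only weak inequalities result.\<close>

lemma
  assumes F: "subalgebra M F" and Q: "Q \<in> sets F"
  shows gain_le_best: "gain Q \<le> gain {\<omega> \<in> space M. posterior M S F \<omega> > 1/2}"
    and best_gain_AE: "gain Q \<ge> gain {\<omega> \<in> space M. posterior M S F \<omega> > 1/2} \<Longrightarrow>
      AE \<omega> in M. (\<omega> \<in> Q \<longrightarrow> posterior M S F \<omega> \<ge> 1/2) \<and> (\<omega> \<notin> Q \<longrightarrow> posterior M S F \<omega> \<le> 1/2)"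
proof -
  interpret F: finite_measure_subalgebra M F by standard (rule F)
  let ?X = "posterior M S F"
  let ?P = "{\<omega> \<in> space M. ?X \<omega> > 1/2}"
  have sp: "space M = space F" using F by (simp add: subalgebra_def)
  have P: "?P \<in> sets F" unfolding sp posterior_eq by measurable
  let ?h = "\<lambda>\<omega>. indicator ?P \<omega> * (2 * ?X \<omega> - 1) - indicator Q \<omega> * (2 * ?X \<omega> - 1)"
  have int: "integrable M ?h"
    by (intro Bochner_Integration.integrable_diff integrable_posterior F P Q)
  have diff: "gain ?P - gain Q = (\<integral>\<omega>. ?h \<omega> \<partial>M)"
    unfolding gain_eq_integral[OF F P] gain_eq_integral[OF F Q]
    by (rule Bochner_Integration.integral_diff[symmetric]) (intro integrable_posterior F P Q)+
  have nonneg: "0 \<le> ?h \<omega>" if "\<omega> \<in> space M" for \<omega> using that by (auto split: split_indicator)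
  then have "0 \<le> (\<integral>\<omega>. ?h \<omega> \<partial>M)" by (intro integral_nonneg_AE AE_I2)
  then show "gain Q \<le> gain ?P" using diff by simp
  then have "(\<integral>\<omega>. ?h \<omega> \<partial>M) = 0" if "gain Q \<ge> gain ?P" using that diff by simp
  then have "AE \<omega> in M. ?h \<omega> = 0" if "gain Q \<ge> gain ?P"
    using that integral_nonneg_eq_0_iff_AE[OF int AE_I2[OF nonneg]] by simp
  then show "AE \<omega> in M. (\<omega> \<in> Q \<longrightarrow> ?X \<omega> \<ge> 1/2) \<and> (\<omega> \<notin> Q \<longrightarrow> ?X \<omega> \<le> 1/2)" if "gain Q \<ge> gain ?P"
    using AE_space that by (auto elim!: eventually_elim2 split: split_indicator_asm)
qed

end

section \<open>Limit actions are optimal for observers\<close>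

context social_learning
begin

definition "plays u t = {\<omega> \<in> space M. A u t \<omega> = 1}"
text \<open>By \<open>gain_le_best\<close>, this is the maximum of \<open>gain\<close> over the
  events of \<open>Lim_info u\<close>.\<close>

definition "optimal_gain u = gain {\<omega> \<in> space M. belief u \<omega> > 1/2}"

lemma plays_in_Info: "u \<in> pverts G \<Longrightarrow> 1 \<le> t \<Longrightarrow> plays u t \<in> sets (Info u t)"
  using action_in_Info[of u t "{1}"] by (simp add: plays_def vimage_def Int_def conj_commute)

lemma plays_events: "u \<in> pverts G \<Longrightarrow> 1 \<le> t \<Longrightarrow> plays u t \<in> events"
  using plays_in_Info Info_events by blast

text \<open>Playing 1 certifies a posterior of at least 1/2 and playing 0 one of at most 1/2,
  however ties are broken, so the density of \<open>gain\<close> has a constant sign on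
  \<open>R\<close>. Later arguments need this for sub-events, not just for the whole event of
  playing 1.\<close>

lemma
  assumes u: "u \<in> pverts G" "1 \<le> t" and R: "R \<in> sets (Info u t)"
  shows gain_nonneg_if_plays: "R \<subseteq> plays u t \<Longrightarrow> 0 \<le> gain R"
    and gain_nonpos_if_not_plays: "R \<inter> plays u t = {} \<Longrightarrow> gain R \<le> 0"
proof -
  let ?X = "posterior M S (Info u t)"
  note eq = gain_eq_integral[OF subalgebra_Info[OF u(1)] R]
  have "R \<subseteq> space M" using sets.sets_into_space[OF R] by simp
  then have R01: "A u t \<omega> = 0 \<or> \<omega> \<in> plays u t" if "\<omega> \<in> R" for \<omega>
    using action_01[OF u, of \<omega>] that by (auto simp: plays_def)
  show "0 \<le> gain R" if "R \<subseteq> plays u t"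
  proof -
    have "AE \<omega> in M. 0 \<le> indicator R \<omega> * (2 * ?X \<omega> - 1)"
      using action_myopic[OF u]
      by eventually_elim (use that in \<open>force simp: plays_def split: split_indicator\<close>)
    then show ?thesis unfolding eq by (rule integral_nonneg_AE)
  qed
  show "gain R \<le> 0" if "R \<inter> plays u t = {}"
  proof -
    have "AE \<omega> in M. 0 \<le> - (indicator R \<omega> * (2 * ?X \<omega> - 1))"
      using action_myopic[OF u]
      by eventually_elim (use that R01 in \<open>force split: split_indicator\<close>)
    then have "0 \<le> (\<integral>\<omega>. - (indicator R \<omega> * (2 * ?X \<omega> - 1)) \<partial>M)" by (rule integral_nonneg_AE)
    then show ?thesis unfolding eq by simp
  qed
qed

lemma gain_plays_optimal:
  assumes u: "u \<in> pverts G" "1 \<le> t" and R: "R \<in> sets (Info u t)"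
  shows "gain R \<le> gain (plays u t)"
proof -
  note P = plays_in_Info[OF u]
  have "0 \<le> gain (plays u t - R)" by (rule gain_nonneg_if_plays[OF u]) (use P R in auto)
  moreover have "gain (R - plays u t) \<le> 0" by (rule gain_nonpos_if_not_plays[OF u]) (use P R in auto)
  moreover have "gain (plays u t - R) - gain (R - plays u t) = gain (plays u t) - gain R"
    using P R Info_events[OF u(1)] by (intro gain_Diff) auto
  ultimately show ?thesis by simp
qed

text \<open>The best limit event is close to some event \<open>R\<close> known at a finite time, and
  \<open>gain\<close> changes by at most the measure of the symmetric difference. From that time on
  \<open>R\<close> stays known, so the current action does at least as well as
  \<open>R\<close>.\<close>

lemma optimal_gain_approx:
  assumes u: "u \<in> pverts G" and "0 < e"
  shows "\<exists>n. \<forall>m\<ge>n. optimal_gain u - e \<le> gain (plays u (Suc m))"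
proof -
  let ?P = "{\<omega> \<in> space M. belief u \<omega> > 1/2}"
  have "?P \<in> sets (Lim_info u)"
  proof -
    have "?P = {\<omega> \<in> space (Lim_info u). belief u \<omega> > 1/2}" by simp
    also have "\<dots> \<in> sets (Lim_info u)" unfolding posterior_eq by measurable
    finally show ?thesis .
  qed
  \<comment> \<open>Reindexing: time starts at 1, the stages of the approximation at 0.\<close>
  moreover have "(\<Union>t\<in>{1..}. sets (Info u t)) = (\<Union>n. sets (Info u (Suc n)))"
    by (auto simp: Suc_le_eq gr0_conv_Suc)
  ultimately have P: "?P \<in> sigma_sets (space M) (\<Union>n. sets (Info u (Suc n)))" by (simp add: sets_Lim_info)
  obtain n R where R: "R \<in> sets (Info u (Suc n))" "prob ((?P - R) \<union> (R - ?P)) < e"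
    using sigma_sets_approx[of "\<lambda>n. Info u (Suc n)", OF subalgebra_Info[OF u] Info_mono P \<open>0 < e\<close>] by auto
  have PM: "?P \<in> events" "R \<in> events"
    using \<open>?P \<in> sets (Lim_info u)\<close> Lim_info_events[OF u] R Info_events[OF u] by blast+
  have "optimal_gain u - gain R = gain (?P - R) - gain (R - ?P)"
    unfolding optimal_gain_def using gain_Diff[OF PM] by simp
  also have "\<dots> \<le> prob (?P - R) + prob (R - ?P)"
    using abs_gain_le[of "?P - R"] abs_gain_le[of "R - ?P"] PM by (simp add: abs_le_iff)
  also have "\<dots> = prob ((?P - R) \<union> (R - ?P))"
    using PM by (intro finite_measure_Union[symmetric]) auto
  also have "\<dots> < e" by fact
  finally have "optimal_gain u - e \<le> gain R" by simp
  also have "gain R \<le> gain (plays u (Suc m))" if "n \<le> m" for m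
    using R(1) Info_mono[of "Suc n" "Suc m" u] that by (intro gain_plays_optimal u) auto
  finally show ?thesis by blast
qed

section \<open>Gain of the limit actions\<close>

text \<open>The limsup and the liminf of the events \<open>plays u t\<close>; \<open>Suc\<close>
  skips time 0.\<close>

definition "plays_often u = (\<Inter>n. \<Union>k. plays u (Suc (n + k)))"
definition "plays_eventually u = (\<Union>n. \<Inter>k. plays u (Suc (n + k)))"

text \<open>Each enlargement adds the event that \<open>u\<close> plays 1 at the new time but at no
  earlier time of the window. At the new time \<open>u\<close> knows this event and plays 1 on it,
  so its gain is non-negative.\<close>

lemma gain_plays_Un:
  assumes u: "u \<in> pverts G"
  shows "gain (plays u (Suc n)) \<le> gain (\<Union>k\<le>m. plays u (Suc (n + k)))"
proof (induction m)
  case (Suc m)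
  let ?Q = "\<Union>k\<le>m. plays u (Suc (n + k))" and ?R = "plays u (Suc (n + Suc m))"
  have Q: "?Q \<in> sets (Info u (Suc (n + Suc m)))"
  proof (intro sets.finite_UN)
    fix k assume "k \<in> {..m}"
    then show "plays u (Suc (n + k)) \<in> sets (Info u (Suc (n + Suc m)))"
      using plays_in_Info[OF u, of "Suc (n + k)"] Info_mono[of "Suc (n + k)" "Suc (n + Suc m)" u] by auto
  qed simp
  have R: "?R \<in> sets (Info u (Suc (n + Suc m)))" using u by (intro plays_in_Info) auto
  have "(\<Union>k\<le>Suc m. plays u (Suc (n + k))) = ?Q \<union> (?R - ?Q)" by (auto simp: atMost_Suc)
  then have "gain (\<Union>k\<le>Suc m. plays u (Suc (n + k))) = gain (?Q \<union> (?R - ?Q))" by simp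
  also have "\<dots> = gain ?Q + gain (?R - ?Q)"
    using Q R Info_events[OF u] by (intro gain_disjoint_Un) auto
  also have "\<dots> \<ge> gain ?Q"
    using gain_nonneg_if_plays[OF u, of "Suc (n + Suc m)" "?R - ?Q"] Q R by auto
  finally show ?case using Suc by simp
qed simp

text \<open>Dually, each further intersection discards an event on which \<open>u\<close> plays 0 at
  the new time, hence one of non-positive gain.\<close>

lemma gain_plays_Int:
  assumes u: "u \<in> pverts G"
  shows "gain (plays u (Suc n)) \<le> gain (\<Inter>k\<le>m. plays u (Suc (n + k)))"
proof (induction m)
  case (Suc m)
  let ?Q = "\<Inter>k\<le>m. plays u (Suc (n + k))" and ?R = "plays u (Suc (n + Suc m))"
  have Q: "?Q \<in> sets (Info u (Suc (n + Suc m)))"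
  proof (intro sets.finite_INT)
    fix k assume "k \<in> {..m}"
    then show "plays u (Suc (n + k)) \<in> sets (Info u (Suc (n + Suc m)))"
      using plays_in_Info[OF u, of "Suc (n + k)"] Info_mono[of "Suc (n + k)" "Suc (n + Suc m)" u] by auto
  qed auto
  have R: "?R \<in> sets (Info u (Suc (n + Suc m)))" using u by (intro plays_in_Info) auto
  have "?Q = (\<Inter>k\<le>Suc m. plays u (Suc (n + k))) \<union> (?Q - ?R)" by (auto simp: atMost_Suc)
  then have "gain ?Q = gain ((\<Inter>k\<le>Suc m. plays u (Suc (n + k))) \<union> (?Q - ?R))" by simp
  also have "(\<Inter>k\<le>Suc m. plays u (Suc (n + k))) = ?Q \<inter> ?R" by (auto simp: atMost_Suc)
  also have "gain ((?Q \<inter> ?R) \<union> (?Q - ?R)) = gain (?Q \<inter> ?R) + gain (?Q - ?R)"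
    using Q R Info_events[OF u] by (intro gain_disjoint_Un) auto
  also have "\<dots> \<le> gain (?Q \<inter> ?R)"
    using gain_nonpos_if_not_plays[OF u, of "Suc (n + Suc m)" "?Q - ?R"] Q R by auto
  also have "?Q \<inter> ?R = (\<Inter>k\<le>Suc m. plays u (Suc (n + k)))" by (auto simp: atMost_Suc)
  finally show ?case using Suc by simp
qed simp

text \<open>The finite unions increase to the tail union \<open>Q n\<close>, and the
  \<open>Q n\<close> decrease to the limsup. Continuity of \<open>gain\<close> carries the lower
  bound through both limits.\<close>

lemma optimal_gain_le_gain_often:
  assumes u: "u \<in> pverts G"
  shows "optimal_gain u \<le> gain (plays_often u)"
proof (rule field_le_epsilon)
  fix e :: real assume "0 < e"
  note ev = plays_events[OF u]
  define Q where "Q n = (\<Union>k. plays u (Suc (n + k)))" for n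
  have QM: "range Q \<subseteq> events" using ev by (auto simp: Q_def)
  have "gain (plays u (Suc n)) \<le> gain (Q n)" for n
  proof -
    have "(\<lambda>m. gain (\<Union>k\<le>m. plays u (Suc (n + k)))) \<longlonglongrightarrow> gain (\<Union>m. \<Union>k\<le>m. plays u (Suc (n + k)))"
      using ev by (intro gain_incseq) (auto simp: incseq_def intro: order_trans)
    also have "(\<Union>m. \<Union>k\<le>m. plays u (Suc (n + k))) = Q n" by (auto simp: Q_def)
    finally show ?thesis by (rule LIMSEQ_le_const) (use gain_plays_Un[OF u] in auto)
  qed
  moreover have "(\<lambda>n. gain (Q n)) \<longlonglongrightarrow> gain (\<Inter>n. Q n)"
  proof (intro gain_decseq QM decseq_SucI subsetI)
    fix n x assume "x \<in> Q (Suc n)"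
    then obtain k where "x \<in> plays u (Suc (n + Suc k))" by (auto simp: Q_def)
    then show "x \<in> Q n" unfolding Q_def by blast
  qed
  moreover obtain n where "\<forall>m\<ge>n. optimal_gain u - e \<le> gain (plays u (Suc m))" using optimal_gain_approx[OF u \<open>0 < e\<close>] by blast
  ultimately have "optimal_gain u - e \<le> gain (\<Inter>n. Q n)" by (intro LIMSEQ_le_const) (auto intro: order_trans)
  then show "optimal_gain u \<le> gain (plays_often u) + e" by (simp add: plays_often_def Q_def)
qed

lemma optimal_gain_le_gain_eventually:
  assumes u: "u \<in> pverts G"
  shows "optimal_gain u \<le> gain (plays_eventually u)"
proof (rule field_le_epsilon)
  fix e :: real assume "0 < e"
  note ev = plays_events[OF u]
  define Q where "Q n = (\<Inter>k. plays u (Suc (n + k)))" for n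
  have QM: "range Q \<subseteq> events" using ev by (auto simp: Q_def)
  have "gain (plays u (Suc n)) \<le> gain (Q n)" for n
  proof -
    have "(\<lambda>m. gain (\<Inter>k\<le>m. plays u (Suc (n + k)))) \<longlonglongrightarrow> gain (\<Inter>m. \<Inter>k\<le>m. plays u (Suc (n + k)))"
      using ev by (intro gain_decseq) (auto simp: decseq_def intro: order_trans)
    also have "(\<Inter>m. \<Inter>k\<le>m. plays u (Suc (n + k))) = Q n" by (auto simp: Q_def)
    finally show ?thesis by (rule LIMSEQ_le_const) (use gain_plays_Int[OF u] in auto)
  qed
  moreover have "(\<lambda>n. gain (Q n)) \<longlonglongrightarrow> gain (\<Union>n. Q n)"
  proof (intro gain_incseq QM incseq_SucI subsetI)
    fix n x assume *: "x \<in> Q n"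
    have "x \<in> plays u (Suc (Suc n + k))" for k
      using * unfolding Q_def by (auto dest: spec[of _ "Suc k"])
    then show "x \<in> Q (Suc n)" unfolding Q_def by blast
  qed
  moreover obtain n where "\<forall>m\<ge>n. optimal_gain u - e \<le> gain (plays u (Suc m))" using optimal_gain_approx[OF u \<open>0 < e\<close>] by blast
  ultimately have "optimal_gain u - e \<le> gain (\<Union>n. Q n)" by (intro LIMSEQ_le_const) (auto intro: order_trans)
  then show "optimal_gain u \<le> gain (plays_eventually u) + e" by (simp add: plays_eventually_def Q_def)
qed

lemma plays_in_Lim_info:
  assumes u: "u \<in> pverts G" "1 \<le> t" and v: "v = u \<or> (v, u) \<in> parcs G"
  shows "plays u t \<in> sets (Lim_info v)"
  using v
proof
  assume "v = u"
  then show ?thesis using plays_in_Info[OF u] Info_subset_Lim_info[OF u(2), of u] by auto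
next
  assume arc: "(v, u) \<in> parcs G"
  have "plays u t = A u t -` {1} \<inter> space M" by (auto simp: plays_def)
  \<comment> \<open>Observers see an action with a delay of one step, hence
    \<open>Suc t\<close>.\<close>
  then have "plays u t \<in> observations v (Suc t)" unfolding observations_def using arc u(2) by blast
  then have "plays u t \<in> sets (Info v (Suc t))" by (simp add: sets_Info)
  then show ?thesis using Info_subset_Lim_info[of "Suc t" v] by auto
qed

lemma often_eventually_in_Lim_info:
  assumes "u \<in> pverts G" "v = u \<or> (v, u) \<in> parcs G"
  shows "plays_often u \<in> sets (Lim_info v)" "plays_eventually u \<in> sets (Lim_info v)"
proof -
  have "plays u (Suc n) \<in> sets (Lim_info v)" for n using assms by (intro plays_in_Lim_info) auto
  then show "plays_often u \<in> sets (Lim_info v)" "plays_eventually u \<in> sets (Lim_info v)"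
    unfolding plays_often_def plays_eventually_def by auto
qed

section \<open>Imitation across the network\<close>

lemma optimal_gain_mono_arc:
  assumes "(v, u) \<in> parcs G"
  shows "optimal_gain u \<le> optimal_gain v"
proof -
  note a = arc_agents[OF assms]
  have "optimal_gain u \<le> gain (plays_often u)" by (rule optimal_gain_le_gain_often[OF a(2)])
  also have "\<dots> \<le> optimal_gain v" unfolding optimal_gain_def
    using a assms by (intro gain_le_best subalgebra_Lim_info often_eventually_in_Lim_info) auto
  finally show ?thesis .
qed

text \<open>Strong connectivity turns a property that passes along arcs, from the observer to the
  observed, into one that reaches every agent.\<close>

lemma network_induct:
  assumes "u \<in> pverts G" "v \<in> pverts G" and "P u"
    and "\<And>x y. (x, y) \<in> parcs G \<Longrightarrow> P x \<Longrightarrow> P y"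
  shows "P v"
proof -
  have "u \<rightarrow>\<^sup>*\<^bsub>with_proj G\<^esub> v"
    using strongly_connected_network assms(1,2) unfolding strongly_connected_def by simp
  then show ?thesis unfolding reachable_def by (rule rtrancl_on_induct) (use assms(3,4) in auto)
qed

lemma optimal_gain_eq:
  assumes "u \<in> pverts G" "v \<in> pverts G"
  shows "optimal_gain u = optimal_gain v"
proof -
  have "optimal_gain v \<le> optimal_gain u" if "u \<in> pverts G" "v \<in> pverts G" for u v
    \<comment> \<open>Along an arc the optimal gain can only drop, so nobody exceeds the agent at
      the start of the path; exchanging the two agents gives equality.\<close>
    using that by (rule network_induct) (auto intro: order_trans optimal_gain_mono_arc)
  then show ?thesis using assms by (intro antisym)
qed

text \<open>With equal optimal gains, both limit events of \<open>u\<close> attain the maximum of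
  \<open>v\<close>, and the equality case of optimality applies to each. The larger event is used
  for its points and the smaller one for its complement, which are the stronger halves; where
  \<open>u\<close> oscillates they force \<open>belief v\<close> to be exactly 1/2.\<close>

lemma often_eventually_AE:
  assumes v: "v \<in> pverts G" and u: "u \<in> pverts G" "v = u \<or> (v, u) \<in> parcs G"
  shows "AE \<omega> in M. (\<omega> \<in> plays_often u \<longrightarrow> belief v \<omega> \<ge> 1/2) \<and> (\<omega> \<notin> plays_eventually u \<longrightarrow> belief v \<omega> \<le> 1/2)"
proof -
  note best = best_gain_AE[OF subalgebra_Lim_info[OF v], folded optimal_gain_def]
  have "AE \<omega> in M. \<omega> \<in> plays_often u \<longrightarrow> belief v \<omega> \<ge> 1/2"
    using best[OF often_eventually_in_Lim_info(1)[OF u]] optimal_gain_le_gain_often[OF u(1)] optimal_gain_eq[OF u(1) v] by auto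
  moreover have "AE \<omega> in M. \<omega> \<notin> plays_eventually u \<longrightarrow> belief v \<omega> \<le> 1/2"
    using best[OF often_eventually_in_Lim_info(2)[OF u]] optimal_gain_le_gain_eventually[OF u(1)] optimal_gain_eq[OF u(1) v] by auto
  ultimately show ?thesis by eventually_elim auto
qed

end

section \<open>Independence of private signals\<close>

context social_learning
begin

abbreviation "signals \<omega> \<equiv> \<lambda>v\<in>pverts G. W v \<omega>"
definition "other_signals u = sigma (space M) (\<Union>v\<in>pverts G - {u}. {W v -` B \<inter> space M |B. B \<in> sets \<mu>0})"

lemma signals_measurable: "signals \<in> measurable M (Pi\<^sub>M (pverts G) (\<lambda>_. \<mu>0))"
  by (intro measurable_restrict signal_measurable)

lemma sets_PiM_signals: "sets (Pi\<^sub>M (pverts G) (\<lambda>_. \<mu>1)) = sets (Pi\<^sub>M (pverts G) (\<lambda>_. \<mu>0))"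
  by (intro sets_PiM_cong) (simp_all add: sets_signals)

lemma
  assumes C: "C \<in> sets (Pi\<^sub>M (pverts G) (\<lambda>_. \<mu>0))"
  shows signals_law1: "emeasure M ({\<omega> \<in> space M. signals \<omega> \<in> C} \<inter> state1) = 1/2 * emeasure (Pi\<^sub>M (pverts G) (\<lambda>_. \<mu>1)) C"
    and signals_law0: "emeasure M ({\<omega> \<in> space M. signals \<omega> \<in> C} \<inter> state0) = 1/2 * emeasure (Pi\<^sub>M (pverts G) (\<lambda>_. \<mu>0)) C"
proof -
  let ?P0 = "Pi\<^sub>M (pverts G) (\<lambda>_. \<mu>0)" and ?P1 = "Pi\<^sub>M (pverts G) (\<lambda>_. \<mu>1)"
  interpret P0: prob_space ?P0 by (intro prob_space_PiM prob_space_signals)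
  interpret P1: prob_space ?P1 by (intro prob_space_PiM prob_space_signals)
  let ?c = "count_space {0, 1} :: nat measure"
  have m: "(\<lambda>\<omega>. (S \<omega>, signals \<omega>)) \<in> measurable M (?c \<Otimes>\<^sub>M ?P0)"
    by (intro measurable_Pair state_measurable signals_measurable)
  \<comment> \<open>The indicators select the summand of the joint law that belongs to
    \<open>s\<close>.\<close>
  have law: "emeasure M {\<omega> \<in> space M. S \<omega> = s \<and> signals \<omega> \<in> C} =
      1/2 * (indicator {s} 0 * emeasure ?P0 C) + 1/2 * (indicator {s} 1 * emeasure ?P1 C)"
    if s: "s \<in> {0, 1}" for s
  proof -
    have B: "{s} \<times> C \<in> sets (?c \<Otimes>\<^sub>M ?P0)" using s C by (intro pair_measureI) auto
    have "emeasure (distr M (?c \<Otimes>\<^sub>M ?P0) (\<lambda>\<omega>. (S \<omega>, signals \<omega>))) ({s} \<times> C) =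
      emeasure M ((\<lambda>\<omega>. (S \<omega>, signals \<omega>)) -` ({s} \<times> C) \<inter> space M)"
      by (rule emeasure_distr[OF m B])
    also have "(\<lambda>\<omega>. (S \<omega>, signals \<omega>)) -` ({s} \<times> C) \<inter> space M = {\<omega> \<in> space M. S \<omega> = s \<and> signals \<omega> \<in> C}"
      by auto
    finally have "emeasure M {\<omega> \<in> space M. S \<omega> = s \<and> signals \<omega> \<in> C} =
      emeasure (distr M (?c \<Otimes>\<^sub>M ?P0) (\<lambda>\<omega>. (S \<omega>, signals \<omega>))) ({s} \<times> C)" by (rule sym)
    also have "\<dots> =
      1/2 * emeasure (return ?c 0 \<Otimes>\<^sub>M ?P0) ({s} \<times> C) + 1/2 * emeasure (return ?c 1 \<Otimes>\<^sub>M ?P1) ({s} \<times> C)"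
      by (rule joint_law[OF B])
    also have "emeasure (return ?c 0 \<Otimes>\<^sub>M ?P0) ({s} \<times> C) = indicator {s} 0 * emeasure ?P0 C"
      using s C by (subst P0.emeasure_pair_measure_Times) (auto simp: emeasure_return)
    also have "emeasure (return ?c 1 \<Otimes>\<^sub>M ?P1) ({s} \<times> C) = indicator {s} 1 * emeasure ?P1 C"
      using s C sets_PiM_signals by (subst P1.emeasure_pair_measure_Times) (auto simp: emeasure_return)
    finally show ?thesis .
  qed
  have S01: "S \<omega> = 0 \<or> S \<omega> = 1" if "\<omega> \<in> space M" for \<omega>
    using measurable_space[OF state_measurable that] by auto
  have "{\<omega> \<in> space M. signals \<omega> \<in> C} \<inter> state1 = {\<omega> \<in> space M. S \<omega> = 1 \<and> signals \<omega> \<in> C}"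
    by (auto simp: state1_def)
  then show "emeasure M ({\<omega> \<in> space M. signals \<omega> \<in> C} \<inter> state1) = 1/2 * emeasure ?P1 C"
    using law[of 1] by simp
  have "{\<omega> \<in> space M. signals \<omega> \<in> C} \<inter> state0 = {\<omega> \<in> space M. S \<omega> = 0 \<and> signals \<omega> \<in> C}"
    using S01 by (auto simp: state1_def state0_def)
  then show "emeasure M ({\<omega> \<in> space M. signals \<omega> \<in> C} \<inter> state0) = 1/2 * emeasure ?P0 C"
    using law[of 0] by simp
qed

lemma space_other_signals[simp]: "space (other_signals u) = space M"
  by (simp add: other_signals_def space_measure_of_conv)

lemma sets_other_signals:
  "sets (other_signals u) = sigma_sets (space M) (\<Union>v\<in>pverts G - {u}. {W v -` B \<inter> space M |B. B \<in> sets \<mu>0})"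
  unfolding other_signals_def by (rule sets_measure_of) auto

lemma other_signals_events: "sets (other_signals u) \<subseteq> events"
  unfolding sets_other_signals
proof (intro sets.sigma_sets_subset UN_least subsetI)
  fix v x assume "v \<in> pverts G - {u}" "x \<in> {W v -` B \<inter> space M |B. B \<in> sets \<mu>0}"
  then show "x \<in> events" using measurable_sets[OF signal_measurable] by blast
qed

text \<open>No observation time precedes time 1, so the generators consist of the preimages under
  \<open>W u\<close>, which already form a sigma-algebra.\<close>

lemma Info_1_vimage:
  assumes u: "u \<in> pverts G" and B: "B \<in> sets (Info u 1)"
  shows "\<exists>B'\<in>sets \<mu>0. B = W u -` B' \<inter> space M"
proof -
  have W: "W u \<in> space M \<rightarrow> space \<mu>0" using measurable_space[OF signal_measurable[OF u]] by auto
  have "observations u 1 = sets (vimage_algebra (space M) (W u) \<mu>0)"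
    unfolding sets_vimage_algebra2[OF W] by (auto simp: observations_def)
  then have "sets (Info u 1) = sets (vimage_algebra (space M) (W u) \<mu>0)"
    using sets.sigma_sets_eq[of "vimage_algebra (space M) (W u) \<mu>0"] by (simp add: sets_Info)
  then show ?thesis using B unfolding sets_vimage_algebra2[OF W] by auto
qed

text \<open>\<open>E\<close> and \<open>\<mu>\<close> are left abstract to serve both states. On
  \<open>E\<close> the signals have half a product law, so the product formula of that law becomes
  one for \<open>prob\<close>, and the halves combine to the factor 2.\<close>

lemma cond_indep_aux:
  assumes \<mu>: "prob_space \<mu>" "sets \<mu> = sets \<mu>0"
    and law: "\<And>C. C \<in> sets (Pi\<^sub>M (pverts G) (\<lambda>_. \<mu>0)) \<Longrightarrow>
      emeasure M ({\<omega> \<in> space M. signals \<omega> \<in> C} \<inter> E) = 1/2 * emeasure (Pi\<^sub>M (pverts G) (\<lambda>_. \<mu>)) C"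
    and u: "u \<in> pverts G" and B: "B \<in> sets (Info u 1)" and C: "C \<in> sets (other_signals u)"
  shows "prob (B \<inter> C \<inter> E) = 2 * prob (B \<inter> E) * prob (C \<inter> E)"
proof -
  let ?P = "Pi\<^sub>M (pverts G) (\<lambda>_. \<mu>)" and ?N = "Pi\<^sub>M (pverts G) (\<lambda>_. \<mu>0)"
  interpret Q: product_prob_space "\<lambda>_. \<mu>" "pverts G"
    using \<mu>(1) by (simp add: product_prob_space_def product_prob_space_axioms_def product_sigma_finite_def
        prob_space_imp_sigma_finite)
  have stP: "sets ?P = sets ?N" by (intro sets_PiM_cong) (simp_all add: \<mu>)
  have spP: "space ?P = space ?N" using stP by (rule sets_eq_imp_space_eq)
  have sig: "signals \<omega> \<in> space ?P" if "\<omega> \<in> space M" for \<omega>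
    using measurable_space[OF signals_measurable that] spP by simp
  let ?d = "\<lambda>Z. {\<omega> \<in> space M. signals \<omega> \<in> Z}"
  have law': "prob (?d Z \<inter> E) = measure ?P Z / 2" if "Z \<in> sets ?P" for Z
  proof -
    have "ennreal (1/2) = 1/2" using divide_ennreal[of 1 2] by simp
    then have "ennreal (1/2 * measure ?P Z) = 1/2 * emeasure ?P Z"
      by (subst ennreal_mult) (simp_all add: Q.P.emeasure_eq_measure)
    then have "emeasure M (?d Z \<inter> E) = ennreal (1/2 * measure ?P Z)"
      using law[of Z] that stP by simp
    then have "prob (?d Z \<inter> E) = 1/2 * measure ?P Z" by (intro measure_eq_emeasure_eq_ennreal) auto
    then show ?thesis by simp
  qed
  obtain B' where B': "B' \<in> sets \<mu>0" "B = W u -` B' \<inter> space M" using Info_1_vimage[OF u B] by blast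
  define Bu where "Bu = (\<lambda>x. x u) -` B' \<inter> space ?P"
  have Bd: "B = ?d Bu" using sig u by (auto simp: Bu_def B')
  have BuP: "Bu \<in> sets ?P" unfolding Bu_def
    by (rule measurable_sets[OF measurable_component_singleton]) (use u B' \<mu> in auto)
  let ?gen = "\<Union>v\<in>pverts G - {u}. {(\<lambda>x. x v) -` B \<inter> space ?P |B. B \<in> sets \<mu>}"
  \<comment> \<open>An event about the other signals is pulled back from one about the other
    coordinates of the product.\<close>
  have "\<exists>C'. C' \<in> sigma_sets (space ?P) ?gen \<and> C = ?d C'"
    using C unfolding sets_other_signals
  proof induction
    case (Basic a)
    then obtain v D where v: "v \<in> pverts G - {u}" "D \<in> sets \<mu>0" "a = W v -` D \<inter> space M" by auto
    then have "a = ?d ((\<lambda>x. x v) -` D \<inter> space ?P)" using sig by auto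
    moreover have "(\<lambda>x. x v) -` D \<inter> space ?P \<in> ?gen" using v \<mu> by blast
    ultimately show ?case by (blast intro: sigma_sets.Basic)
  next
    case Empty then show ?case by (intro exI[of _ "{}"]) (auto intro: sigma_sets.Empty)
  next
    case (Compl a)
    then obtain C' where C': "C' \<in> sigma_sets (space ?P) ?gen" "a = ?d C'" by blast
    have "space M - a = ?d (space ?P - C')" unfolding C'(2) using sig by auto
    with sigma_sets.Compl[OF C'(1)] show ?case by blast
  next
    case (Union a)
    then have "\<forall>i. \<exists>C'. C' \<in> sigma_sets (space ?P) ?gen \<and> a i = ?d C'" by blast
    from choice[OF this] obtain C' where
      C': "\<And>i. C' i \<in> sigma_sets (space ?P) ?gen" "\<And>i. a i = ?d (C' i)" by blast
    have "\<Union> (range a) = ?d (\<Union> (range C'))" unfolding C'(2) by auto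
    with C'(1) show ?case by (blast intro: sigma_sets.Union)
  qed
  then obtain C' where C': "C' \<in> sigma_sets (space ?P) ?gen" "C = ?d C'" by blast
  have "?gen \<subseteq> sets ?P"
  proof (intro UN_least subsetI)
    fix v x assume "v \<in> pverts G - {u}" "x \<in> {(\<lambda>x. x v) -` B \<inter> space ?P |B. B \<in> sets \<mu>}"
    then show "x \<in> sets ?P" using measurable_sets[OF measurable_component_singleton[of v "pverts G" "\<lambda>_. \<mu>"]] by blast
  qed
  then have C'P: "C' \<in> sets ?P" using C'(1) sets.sigma_sets_subset by blast
  have "B \<inter> C = ?d (Bu \<inter> C')" using Bd C'(2) by auto
  then have "prob (B \<inter> C \<inter> E) = measure ?P (Bu \<inter> C') / 2" using law'[of "Bu \<inter> C'"] BuP C'P by simp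
  also have "measure ?P (Bu \<inter> C') = measure ?P Bu * measure ?P C'"
    unfolding Bu_def using Q.indep_coordinate_others[OF u _ C'(1)] B' \<mu> by auto
  also have "measure ?P Bu = 2 * prob (B \<inter> E)" using law'[OF BuP] Bd by simp
  also have "measure ?P C' = 2 * prob (C \<inter> E)" using law'[OF C'P] C'(2) by simp
  finally show ?thesis by simp
qed

lemma
  assumes "u \<in> pverts G" "B \<in> sets (Info u 1)" "C \<in> sets (other_signals u)"
  shows cond_indep1: "prob (B \<inter> C \<inter> state1) = 2 * prob (B \<inter> state1) * prob (C \<inter> state1)"
    and cond_indep0: "prob (B \<inter> C \<inter> state0) = 2 * prob (B \<inter> state0) * prob (C \<inter> state0)"
  using cond_indep_aux[OF prob_space_signals(2) sets_signals[symmetric] signals_law1 assms]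
    cond_indep_aux[OF prob_space_signals(1) refl signals_law0 assms] by blast+

end

section \<open>Indifference along a fixed sequence of actions\<close>

context social_learning
begin

text \<open>The bound on \<open>s\<close> is strict: these are the actions of \<open>u\<close> to
  which another agent can have reacted by time \<open>t\<close>.\<close>

definition "history u a t = {\<omega> \<in> space M. \<forall>s. 1 \<le> s \<longrightarrow> s < t \<longrightarrow> A u s \<omega> = a s}"
definition "trajectory u a = {\<omega> \<in> space M. \<forall>s\<ge>1. A u s \<omega> = a s}"

lemma history_antimono: "s \<le> t \<Longrightarrow> history u a t \<subseteq> history u a s"
  by (auto simp: history_def)

lemma trajectory_subset_history: "trajectory u a \<subseteq> history u a t"
  by (auto simp: trajectory_def history_def)

text \<open>An action of \<open>v\<close> is determined by the signal of \<open>v\<close> and the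
  earlier actions that \<open>v\<close> observes. On the history those of \<open>u\<close> are
  constants, and those of other agents reduce to signals other than that of \<open>u\<close> by
  induction.\<close>

lemma action_trace_other_signals:
  assumes "v \<in> pverts G" "v \<noteq> u" "1 \<le> t"
  shows "\<exists>H\<in>sets (other_signals u). (A v t -` C \<inter> space M) \<inter> history u a t = H \<inter> history u a t"
  using assms
proof (induction t arbitrary: v C rule: less_induct)
  case (less t)
  have "A v t -` C \<inter> space M \<in> sigma_sets (space M) (observations v t)"
    using action_in_Info[OF less(2,4)] by (simp add: sets_Info)
  then show ?case
  proof (rule sigma_sets_trace)
    fix g assume "g \<in> observations v t"
    then consider B where "g = W v -` B \<inter> space M" "B \<in> sets \<mu>0"
      | w s C where "g = A w s -` C \<inter> space M" "(v, w) \<in> parcs G" "1 \<le> s" "s < t"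
      by (auto simp: observations_def)
    then show "\<exists>H\<in>sets (other_signals u). g \<inter> history u a t = H \<inter> history u a t"
    proof cases
      case 1
      then have "g \<in> sets (other_signals u)"
        using less(2,3) unfolding sets_other_signals by (intro sigma_sets.Basic) auto
      then show ?thesis by blast
    next
      case 2
      show ?thesis
      proof (cases "w = u")
        case True
        have "A u s \<omega> = a s" if "\<omega> \<in> history u a t" for \<omega>
          using that 2(3,4) by (simp add: history_def)
        \<comment> \<open>On the history the action of \<open>u\<close> is fixed, so an event about
          it is everything or nothing.\<close>
        then have "g \<inter> history u a t = (if a s \<in> C then space M else {}) \<inter> history u a t"
          unfolding 2(1) True by auto
        moreover have "(if a s \<in> C then space M else {}) \<in> sets (other_signals u)"
          using sets.top[of "other_signals u"] by auto
        ultimately show ?thesis by blast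
      next
        case False
        then obtain H where "H \<in> sets (other_signals u)" "g \<inter> history u a s = H \<inter> history u a s"
          using less(1)[of s w C] 2 arc_agents[of v w] by blast
        moreover have "history u a t \<subseteq> history u a s" using 2 by (intro history_antimono) auto
        ultimately show ?thesis by blast
      qed
    qed
  qed simp
qed

text \<open>
  On \<open>trajectory u a\<close>, what \<open>u\<close> learns from others has the same trace as \<open>social_signals u a\<close>.
  The latter is independent of \<open>W u\<close> given the state, the former is not, since the actions that
  \<open>u\<close> observes react to the actions of \<open>u\<close>.
\<close>

definition "social_signals u a = sigma (space M)
  {H \<in> sets (other_signals u). \<exists>B\<in>sets (Lim_info u). B \<inter> trajectory u a = H \<inter> trajectory u a}"

text \<open>A substitute for \<open>Lim_info u\<close> built from two conditionally independent
  parts. Both contain \<open>trajectory u a\<close> and have the same traces on it, hence they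
  contain the same sub-events of that trajectory.\<close>

definition "decoupled_info u a = sigma (space M) (sets (Info u 1) \<union> sets (social_signals u a))"

lemma space_social_signals[simp]: "space (social_signals u a) = space M"
  by (simp add: social_signals_def space_measure_of_conv)

lemma sets_social_signals: "sets (social_signals u a) = sigma_sets (space M)
  {H \<in> sets (other_signals u). \<exists>B\<in>sets (Lim_info u). B \<inter> trajectory u a = H \<inter> trajectory u a}"
  unfolding social_signals_def
  by (rule sets_measure_of) (use sets.sets_into_space[of _ "other_signals u"] in auto)

lemma social_signals_subset: "sets (social_signals u a) \<subseteq> sets (other_signals u)"
  unfolding sets_social_signals using sets.sigma_sets_subset[of _ "other_signals u"] by simp

lemma space_decoupled_info[simp]: "space (decoupled_info u a) = space M"
  by (simp add: decoupled_info_def space_measure_of_conv)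

lemma sets_decoupled_info:
  "sets (decoupled_info u a) = sigma_sets (space M) (sets (Info u 1) \<union> sets (social_signals u a))"
  unfolding decoupled_info_def
  by (rule sets_measure_of)
    (use sets.sets_into_space[of _ "Info u 1"] sets.sets_into_space[of _ "social_signals u a"] in auto)

text \<open>The own signal is common to both sides. For an observed action \<open>g\<close>, the
  event \<open>H\<close> about other signals with the same trace qualifies for
  \<open>social_signals\<close> because \<open>g\<close> itself is an event of
  \<open>Lim_info u\<close>.\<close>

lemma Info_trace_decoupled:
  assumes u: "u \<in> pverts G" and Q: "Q \<in> sets (Info u t)"
  shows "\<exists>R\<in>sets (decoupled_info u a). Q \<inter> history u a t = R \<inter> history u a t"
  using Q unfolding sets_Info
proof (rule sigma_sets_trace)
  fix g assume g: "g \<in> observations u t"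
  then consider B where "g = W u -` B \<inter> space M" "B \<in> sets \<mu>0"
    | v s C where "g = A v s -` C \<inter> space M" "(u, v) \<in> parcs G" "1 \<le> s" "s < t"
    by (auto simp: observations_def)
  then show "\<exists>R\<in>sets (decoupled_info u a). g \<inter> history u a t = R \<inter> history u a t"
  proof cases
    case 1
    then have "g \<in> sets (Info u 1)" unfolding sets_Info observations_def by blast
    then have "g \<in> sets (decoupled_info u a)" unfolding sets_decoupled_info by blast
    then show ?thesis by blast
  next
    case 2
    then obtain H where H: "H \<in> sets (other_signals u)" "g \<inter> history u a s = H \<inter> history u a s"
      using action_trace_other_signals[of v u s C a] arc_agents[of u v] by blast
    have "g \<in> sets (Lim_info u)"
      using g 2 Info_subset_Lim_info[of t u] by (auto simp: sets_Info)
    moreover have "g \<inter> trajectory u a = H \<inter> trajectory u a" using H(2) trajectory_subset_history[of u a s] by blast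
    ultimately have "H \<in> sets (social_signals u a)" using H(1) unfolding sets_social_signals by blast
    then have "H \<in> sets (decoupled_info u a)" unfolding sets_decoupled_info by blast
    moreover have "history u a t \<subseteq> history u a s" using 2 by (intro history_antimono) auto
    ultimately show ?thesis using H(2) by blast
  qed
qed simp

text \<open>The actions of \<open>u\<close> are not among the generators. But the action at time
  \<open>t\<close> is determined by the information at \<open>t\<close>, which agrees with the
  decoupled one on the history before \<open>t\<close>, so the history can be extended step by
  step.\<close>

lemma history_in_decoupled:
  assumes u: "u \<in> pverts G"
  shows "history u a t \<in> sets (decoupled_info u a)"
proof (induction t)
  case 0
  have "history u a 0 = space (decoupled_info u a)" by (auto simp: history_def)
  then show ?case by (metis sets.top)
next
  case (Suc t)
  show ?case
  proof (cases "t = 0")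
    case True
    \<comment> \<open>No time \<open>s\<close> satisfies both \<open>1 \<le> s\<close> and
      \<open>s < 1\<close>, so the history up to time 1 imposes nothing.\<close>
    then have "history u a (Suc t) = space (decoupled_info u a)" by (auto simp: history_def)
    then show ?thesis by (metis sets.top)
  next
    case False
    let ?Q = "A u t -` {a t} \<inter> space M"
    have "?Q \<in> sets (Info u t)" using False u by (intro action_in_Info) auto
    from Info_trace_decoupled[OF u this, of a] obtain R
      where R: "R \<in> sets (decoupled_info u a)" "?Q \<inter> history u a t = R \<inter> history u a t" by metis
    have "1 \<le> t" using False by simp
    then have "history u a (Suc t) = ?Q \<inter> history u a t" unfolding history_def less_Suc_eq by blast
    then show ?thesis using R Suc by auto
  qed
qed

lemma trajectory_in_decoupled:
  assumes u: "u \<in> pverts G"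
  shows "trajectory u a \<in> sets (decoupled_info u a)"
proof -
  have "trajectory u a = (\<Inter>t. history u a t)" by (auto simp: trajectory_def history_def)
  then show ?thesis using history_in_decoupled[OF u] by auto
qed

lemma trajectory_in_Lim_info:
  assumes u: "u \<in> pverts G"
  shows "trajectory u a \<in> sets (Lim_info u)"
proof -
  define Q where "Q t = A u (Suc t) -` {a (Suc t)} \<inter> space M" for t
  have "range Q \<subseteq> sets (Lim_info u)"
    using action_in_Info[OF u, of "Suc _"] Info_subset_Lim_info[of "Suc _" u] by (auto simp: Q_def)
  then have "(\<Inter>t. Q t) \<in> sets (Lim_info u)" by (rule sets.countable_INT) simp
  also have "(\<Inter>t. Q t) = trajectory u a"
    by (auto simp: trajectory_def Q_def) (metis Suc_le_D One_nat_def)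
  finally show ?thesis .
qed

lemma Lim_info_trace_decoupled:
  assumes u: "u \<in> pverts G" and Q: "Q \<in> sets (Lim_info u)"
  shows "\<exists>R\<in>sets (decoupled_info u a). Q \<inter> trajectory u a = R \<inter> trajectory u a"
  using Q unfolding sets_Lim_info
proof (rule sigma_sets_trace)
  fix g assume "g \<in> (\<Union>t\<in>{1..}. sets (Info u t))"
  then obtain t where "g \<in> sets (Info u t)" by blast
  from Info_trace_decoupled[OF u this, of a] obtain R
    where "R \<in> sets (decoupled_info u a)" "g \<inter> history u a t = R \<inter> history u a t" by metis
  then show "\<exists>R\<in>sets (decoupled_info u a). g \<inter> trajectory u a = R \<inter> trajectory u a"
    using trajectory_subset_history[of u a t] by blast
qed simp

text \<open>This direction is why \<open>social_signals\<close> is cut down from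
  \<open>other_signals\<close>: its generators are required to have traces that \<open>u\<close> can
  learn.\<close>

lemma decoupled_trace_Lim_info:
  assumes u: "u \<in> pverts G" and R: "R \<in> sets (decoupled_info u a)"
  shows "\<exists>Q\<in>sets (Lim_info u). R \<inter> trajectory u a = Q \<inter> trajectory u a"
  using R unfolding sets_decoupled_info
proof (rule sigma_sets_trace)
  fix g assume "g \<in> sets (Info u 1) \<union> sets (social_signals u a)"
  then show "\<exists>Q\<in>sets (Lim_info u). g \<inter> trajectory u a = Q \<inter> trajectory u a"
  proof
    assume "g \<in> sets (Info u 1)"
    then show ?thesis using Info_subset_Lim_info[of 1 u] by blast
  next
    assume "g \<in> sets (social_signals u a)"
    then show ?thesis unfolding sets_social_signals
      by (rule sigma_sets_trace) auto
  qed
qed simp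

section \<open>Indifference forces oscillation\<close>

text \<open>A point of positive mass would be an atom of the law, since its only subsets are the
  empty set and itself.\<close>

lemma AE_initial_belief_neq:
  assumes na: "non_atomic_beliefs M \<mu>0 G S W A" and u: "u \<in> pverts G"
  shows "AE \<omega> in M. posterior M S (Info u 1) \<omega> \<noteq> x"
proof -
  let ?X = "posterior M S (Info u 1)"
  have X[measurable]: "?X \<in> borel_measurable M" unfolding posterior_eq by measurable
  have "emeasure (distr M borel ?X) {x} = 0"
  proof (rule ccontr)
    assume "emeasure (distr M borel ?X) {x} \<noteq> 0"
    then have "0 < emeasure (distr M borel ?X) {x}" by (simp add: zero_less_iff_neq_zero)
    moreover have "emeasure (distr M borel ?X) C = 0"
      if "C \<subseteq> {x}" "emeasure (distr M borel ?X) C < emeasure (distr M borel ?X) {x}" for C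
      using that by (auto simp: subset_singleton_iff)
    ultimately have "\<not> non_atomic (distr M borel ?X)"
      unfolding non_atomic_def not_not by (intro bexI[of _ "{x}"] conjI ballI impI) simp_all
    then show False using na u unfolding non_atomic_beliefs_def by blast
  qed
  then have "emeasure M {\<omega> \<in> space M. ?X \<omega> = x} = 0"
    using emeasure_distr[OF X, of "{x}"] by (simp add: vimage_def Int_def conj_commute)
  moreover have "{\<omega> \<in> space M. ?X \<omega> = x} \<in> events" by measurable
  ultimately show ?thesis by (intro AE_I[of _ _ "{\<omega> \<in> space M. ?X \<omega> = x}"]) (simp_all del: One_nat_def)
qed

lemma prob_half_trajectory:
  assumes na: "non_atomic_beliefs M \<mu>0 G S W A" and u: "u \<in> pverts G"
  shows "prob ({\<omega> \<in> space M. belief u \<omega> = 1/2} \<inter> trajectory u a) = 0"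
proof -
  let ?T = "{\<omega> \<in> space M. belief u \<omega> = 1/2} \<inter> trajectory u a"
  let ?K = "social_signals u a"
  have "{\<omega> \<in> space (Lim_info u). belief u \<omega> = 1/2} \<in> sets (Lim_info u)"
    unfolding posterior_eq by measurable
  then have "{\<omega> \<in> space M. belief u \<omega> = 1/2} \<in> sets (Lim_info u)" by simp
  from Lim_info_trace_decoupled[OF u this] have T: "?T \<in> sets (decoupled_info u a)"
    using trajectory_in_decoupled[OF u] by (metis sets.Int)
  have K: "subalgebra M ?K"
    using social_signals_subset other_signals_events by (fastforce simp: subalgebra_def)
  show ?thesis
  proof (rule posterior_half_null[OF subalgebra_Info[OF u, of 1] K state_events(1), folded state0_def posterior_eq])
    fix B C assume B: "B \<in> sets (Info u 1)" "C \<in> sets ?K"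
    then have C: "C \<in> sets (other_signals u)" using social_signals_subset by blast
    show "prob (B \<inter> C \<inter> state1) = 2 * prob (B \<inter> state1) * prob (C \<inter> state1)"
      by (rule cond_indep1[OF u B(1) C])
    show "prob (B \<inter> C \<inter> state0) = 2 * prob (B \<inter> state0) * prob (C \<inter> state0)"
      by (rule cond_indep0[OF u B(1) C])
  next
    show "AE \<omega> in M. posterior M S (Info u 1) \<omega> \<noteq> x" for x by (rule AE_initial_belief_neq[OF na u])
    show "?T \<in> sigma_sets (space M) (sets (Info u 1) \<union> sets ?K)" using T by (simp add: sets_decoupled_info)
  next
    fix Z assume "Z \<in> sigma_sets (space M) (sets (Info u 1) \<union> sets ?K)" and Z: "Z \<subseteq> ?T"
    then obtain Q where "Q \<in> sets (Lim_info u)" "Z \<inter> trajectory u a = Q \<inter> trajectory u a"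
      using decoupled_trace_Lim_info[OF u] by (metis sets_decoupled_info)
    moreover have "Z \<inter> trajectory u a = Z" using Z by auto
    \<comment> \<open>Being inside the trajectory, \<open>Z\<close> is an event of
      \<open>Lim_info u\<close> as well; there \<open>gain\<close> has the density
      \<open>2 * belief u - 1\<close>, which is 0 on \<open>Z\<close>.\<close>
    ultimately have ZL: "Z \<in> sets (Lim_info u)" using trajectory_in_Lim_info[OF u] by auto
    have "gain Z = (\<integral>\<omega>. indicator Z \<omega> * (2 * belief u \<omega> - 1) \<partial>M)"
      by (rule gain_eq_integral[OF subalgebra_Lim_info[OF u] ZL])
    also have "\<dots> = (\<integral>\<omega>. 0 \<partial>M)"
      by (intro Bochner_Integration.integral_cong refl) (use Z in \<open>auto split: split_indicator\<close>)
    finally show "prob (Z \<inter> state1) = prob (Z \<inter> state0)" by (simp add: gain_def)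
  qed
qed

lemma AE_half_oscillates:
  assumes na: "non_atomic_beliefs M \<mu>0 G S W A" and u: "u \<in> pverts G"
  shows "AE \<omega> in M. belief u \<omega> = 1/2 \<longrightarrow> \<omega> \<in> plays_often u \<and> \<omega> \<notin> plays_eventually u"
proof -
  \<comment> \<open>\<open>b l c\<close> follows the list \<open>l\<close> and is then constantly
    \<open>c\<close>. Lists of numbers are countable, so the exceptional null sets can be
    united.\<close>
  define b where "b l c t = (if t < length l then l ! t else c)" for l :: "nat list" and c t :: nat
  have "AE \<omega> in M. \<omega> \<notin> {\<omega> \<in> space M. belief u \<omega> = 1/2} \<inter> trajectory u a" for a
  proof -
    have "{\<omega> \<in> space M. belief u \<omega> = 1/2} \<inter> trajectory u a \<in> events"
      using trajectory_in_Lim_info[OF u] Lim_info_events[OF u] unfolding posterior_eq by (intro sets.Int) auto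
    then show ?thesis using prob_half_trajectory[OF na u, of a] by (intro AE_not_in) (auto simp: emeasure_eq_measure null_sets_def)
  qed
  then have "AE \<omega> in M. \<forall>l c. \<omega> \<notin> {\<omega> \<in> space M. belief u \<omega> = 1/2} \<inter> trajectory u (b l c)"
    by (simp only: AE_all_countable) simp
  with AE_space show ?thesis
  proof eventually_elim
    case (elim \<omega>)
    have no: False if h: "belief u \<omega> = 1/2" and c: "\<And>k. A u (Suc (n + k)) \<omega> = c" for n c
    proof -
      \<comment> \<open>The prefix starts at time 0 so that list positions equal times; the entry at
        0 is ignored by \<open>trajectory\<close>.\<close>
      have "A u s \<omega> = b (map (\<lambda>t. A u t \<omega>) [0..<Suc n]) c s" for s
      proof (cases "s < Suc n")
        case True then show ?thesis by (simp add: b_def del: upt_Suc)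
      next
        case False
        then have "A u s \<omega> = c" using c[of "s - Suc n"] by simp
        then show ?thesis using False by (simp add: b_def)
      qed
      then have "\<omega> \<in> trajectory u (b (map (\<lambda>t. A u t \<omega>) [0..<Suc n]) c)"
        unfolding trajectory_def using elim by blast
      then show False using elim h by blast
    qed
    show ?case
    proof (intro impI conjI)
      assume h: "belief u \<omega> = 1/2"
      show "\<omega> \<in> plays_often u"
      proof (rule ccontr)
        assume "\<omega> \<notin> plays_often u"
        then obtain n where "\<And>k. \<omega> \<notin> plays u (Suc (n + k))" by (auto simp: plays_often_def)
        then have "A u (Suc (n + k)) \<omega> = 0" for k
          using action_01[OF u, of "Suc (n + k)" \<omega>] elim by (auto simp: plays_def)
        then show False by (rule no[OF h])
      qed
      show "\<omega> \<notin> plays_eventually u"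
      proof
        assume "\<omega> \<in> plays_eventually u"
        then obtain n where "\<And>k. \<omega> \<in> plays u (Suc (n + k))" by (auto simp: plays_eventually_def)
        then have "A u (Suc (n + k)) \<omega> = 1" for k by (auto simp: plays_def)
        then show False by (rule no[OF h])
      qed
    qed
  qed
qed

section \<open>Agreement along arcs and across the network\<close>

lemma eventually_subset_often: "plays_eventually u \<subseteq> plays_often u"
proof
  fix x assume "x \<in> plays_eventually u"
  then obtain n where n: "\<And>k. x \<in> plays u (Suc (n + k))" by (auto simp: plays_eventually_def)
  have "x \<in> plays u (Suc (m + n))" for m using n[of m] by (simp add: add.commute)
  then show "x \<in> plays_often u" unfolding plays_often_def by blast
qed

text \<open>Deliberately one-sided: a strict preference of \<open>v\<close> passes to
  \<open>u\<close>, while nothing is said when \<open>v\<close> is tied. The relation is transitive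
  and so travels along paths; symmetry comes from having it in both directions.\<close>

definition "belief_sides_agree v u \<omega> \<longleftrightarrow>
  (belief v \<omega> > 1/2 \<longrightarrow> belief u \<omega> > 1/2) \<and> (belief v \<omega> < 1/2 \<longrightarrow> belief u \<omega> < 1/2)"

text \<open>If \<open>v\<close> strictly prefers 1, then \<open>u\<close> eventually plays only 1,
  so \<open>belief u\<close> is at least 1/2, and a tie is impossible because a tied
  \<open>u\<close> oscillates. A preference for 0 is handled dually.\<close>

lemma AE_neighbours_agree:
  assumes na: "non_atomic_beliefs M \<mu>0 G S W A" and arc: "(v, u) \<in> parcs G"
  shows "AE \<omega> in M. belief_sides_agree v u \<omega>"
proof -
  note a = arc_agents[OF arc]
  show ?thesis
    using often_eventually_AE[OF a(1) a(2) disjI2[OF arc]] often_eventually_AE[OF a(2) a(2) disjI1[OF refl]]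
      AE_half_oscillates[OF na a(2)]
  proof eventually_elim
    case (elim \<omega>)
    then show ?case using eventually_subset_often[of u] unfolding belief_sides_agree_def
      by (smt (verit) subsetD)
  qed
qed

lemma AE_agree:
  assumes na: "non_atomic_beliefs M \<mu>0 G S W A" and "u \<in> pverts G" "v \<in> pverts G"
  shows "AE \<omega> in M. belief_sides_agree u v \<omega>"
  using assms(2,3)
proof (rule network_induct)
  show "AE \<omega> in M. belief_sides_agree u u \<omega>" by (simp add: belief_sides_agree_def)
  fix x y assume "(x, y) \<in> parcs G" and IH: "AE \<omega> in M. belief_sides_agree u x \<omega>"
  from AE_neighbours_agree[OF na this(1)] IH show "AE \<omega> in M. belief_sides_agree u y \<omega>"
    by eventually_elim (auto simp: belief_sides_agree_def)
qed

lemma optimal_actions_measurable: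
  "optimal_actions M \<mu>0 G S W A u \<in> measurable M (count_space {{0}, {1}, {0, 1}})"
proof -
  have [measurable]: "belief u \<in> borel_measurable M" unfolding posterior_eq by measurable
  have "(\<lambda>\<omega>. if belief u \<omega> < 1/2 then {0} else if belief u \<omega> > 1/2 then {1} else {0, 1 :: nat})
    \<in> measurable M (count_space {{0}, {1}, {0, 1}})"
    by (intro measurable_If measurable_const) auto
  then show ?thesis by (simp add: optimal_actions_def Let_def cong: measurable_cong)
qed

lemma optimal_actions_agree:
  assumes na: "non_atomic_beliefs M \<mu>0 G S W A"
  shows "\<exists>A_opt. A_opt \<in> measurable M (count_space {{0}, {1}, {0, 1}}) \<and>
    (AE \<omega> in M. \<forall>u\<in>pverts G. optimal_actions M \<mu>0 G S W A u \<omega> = A_opt \<omega>)"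
proof -
  obtain r where r: "r \<in> pverts G"
    using strongly_connected_network unfolding strongly_connected_def by auto
  \<comment> \<open>Countability of the agents moves the quantifier inside; the optimal action set
    of the reference agent \<open>r\<close> then serves as the common random variable.\<close>
  have "AE \<omega> in M. \<forall>u\<in>pverts G. belief_sides_agree u r \<omega> \<and> belief_sides_agree r u \<omega>"
    unfolding AE_ball_countable[OF countable_agents] using AE_agree[OF na] r by auto
  then have "AE \<omega> in M. \<forall>u\<in>pverts G. optimal_actions M \<mu>0 G S W A u \<omega> = optimal_actions M \<mu>0 G S W A r \<omega>"
  proof eventually_elim
    case (elim \<omega>)
    show ?case
    proof
      fix u assume "u \<in> pverts G"
      with elim have "belief_sides_agree u r \<omega>" "belief_sides_agree r u \<omega>" by auto
      then show "optimal_actions M \<mu>0 G S W A u \<omega> = optimal_actions M \<mu>0 G S W A r \<omega>"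
        unfolding belief_sides_agree_def optimal_actions_def Let_def
        by (cases "belief u \<omega>" "1/2 :: real" rule: linorder_cases) auto
    qed
  qed
  then show ?thesis using optimal_actions_measurable[of r] by blast
qed

end

theorem theorem1:
  fixes M :: "'a measure"
    and \<mu>0 \<mu>1 :: "'w measure"
    and G :: "'v pair_pre_digraph"
    and S :: "'a \<Rightarrow> nat"
    and W :: "'v \<Rightarrow> 'a \<Rightarrow> 'w"
    and A :: "'v \<Rightarrow> nat \<Rightarrow> 'a \<Rightarrow> nat"
  assumes "social_learning M \<mu>0 \<mu>1 G S W A"
    and "non_atomic_beliefs M \<mu>0 G S W A"
  shows "\<exists>A_opt. A_opt \<in> measurable M (count_space {{0}, {1}, {0, 1}}) \<and>
    (AE \<omega> in M. \<forall>u\<in>pverts G. optimal_actions M \<mu>0 G S W A u \<omega> = A_opt \<omega>)"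
  using social_learning.optimal_actions_agree[OF assms] .

end
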